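(* Let $\epsilon\in\mathbb{C}$ with $\epsilon\notin i\mathbb{R}$. The $S$-transformation of the mixed false theta functions $F^\epsilon_{b,c}$ ($b,c\in\mathbb{Z}$, $c\neq0$) is given by $$F_{b,c}^\epsilon\left(-\frac1\tau\right)=\int_{\mathbb{R}} S^\epsilon_{b,c}(x)\,\mathrm{ch}\bigl[\mathcal{F}^\epsilon_{x+\alpha_0/2}\bigr](\tau)\,dx+\frac{1-\operatorname{sgn}\operatorname{Re}(\epsilon)}{2}\,X^\epsilon_{b,c}(\tau)$$ with the "correction term" $$X^\epsilon_{b,c}(\tau)=\frac{i\,q^{-\epsilon^2/2}}{\sqrt{2p_+p_-}}\sum_{m=0}^{2p_+p_--1}e^{-\pi i\frac{bm}{p_+p_-}}\sin\left(\pi\frac{cm}{p_+p_-}\right)\frac{\theta_{p_+p_-,m}\bigl(i\sqrt{2p_+p_-}\,\epsilon\tau,\tau\bigr)}{\eta(\tau)}$$ and the $S$-kernel $$S^\epsilon_{b,c}(x)=-e^{-2\pi\epsilon x}\,e^{2\pi i\frac{b-p_+p_-}{\sqrt{2p_+p_-}}(x+i\epsilon)}\,\frac{\sin\left(2\pi c\,\frac{x+i\epsilon}{\sqrt{2p_+p_-}}\right)}{\sin\left(\pi\sqrt{2p_+p_-}\,(x+i\epsilon)\right)}.$$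
   Context: Throughout $p_+,p_-\ge 1$ are coprime integers with $p_+\ne p_-$, $\alpha_+=\sqrt{2p_-/p_+}$, $\alpha_-=-\sqrt{2p_+/p_-}$, $\alpha_0=\alpha_++\alpha_-$, $\tau$ lies in the upper half-plane, $q=e^{2\pi i\tau}$ (with $q^x:=e^{2\pi i\tau x}$), $z=e^{2\pi i u}$ (with $z^x:=e^{2\pi iux}$), and $\eta$ is the Dedekind eta function. Theta function: $\theta_{a,b}(u,\tau)=\sum_{k\in\mathbb{Z}}z^{k+\frac{b}{2a}}q^{a(k+\frac{b}{2a})^2}$. Regularised partial theta function: $P^{\epsilon}_{a,b}(u,\tau)=\sum_{k\ge 0}e^{2\pi\epsilon(k+\frac{b}{2a})}z^{k+\frac{b}{2a}}q^{a(k+\frac{b}{2a})^2}$. Mixed false theta function: $F^\epsilon_{b,c}(\tau)=\frac{1}{\eta(\tau)}\Bigl(P^{-\sqrt{2p_+p_-}\,\epsilon}_{p_+p_-,\,b-c}(0,\tau)-P^{-\sqrt{2p_+p_-}\,\epsilon}_{p_+p_-,\,b+c}(0,\tau)\Bigr)$. Regularised character of the Heisenberg Fock module $\mathcal{F}_\lambda$: $\mathrm{ch}[\mathcal{F}^\epsilon_\lambda](\tau)=e^{2\pi\epsilon(\lambda-\alpha_0/2)}\,q^{(\lambda-\alpha_0/2)^2/2}/\eta(\tau)$.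
   Formalization: The printed formula has wrong constants (for Re ε>0 it would force F=0); what is proved is F(-1/τ) = −∫ S·ch dx + 2·((1−sgn Re ε)/2)·X, with S and X exactly as printed. *)

theory Defs
  imports "HOL-Analysis.Analysis"
begin

(* cis_pow t x = exp (2 pi i t x).  Both the power q^x of q = exp (2 pi i tau) and the power z^x of
   z = exp (2 pi i u) mean this, so that no branch of a logarithm enters. *)
definition cis_pow :: "complex \<Rightarrow> complex \<Rightarrow> complex" where
  "cis_pow t x = exp (2 * of_real pi * \<i> * t * x)"

definition dedekind_eta :: "complex \<Rightarrow> complex" where
  "dedekind_eta \<tau> = cis_pow \<tau> (1 / 24) * (\<Prod>n. 1 - cis_pow \<tau> (of_nat (Suc n)))"

definition theta_fn :: "nat \<Rightarrow> int \<Rightarrow> complex \<Rightarrow> complex \<Rightarrow> complex" where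
  "theta_fn a b u \<tau> = (\<Sum>\<^sub>\<infinity>k\<in>(UNIV :: int set).
     cis_pow u (of_int k + of_int b / (2 * of_nat a)) *
     cis_pow \<tau> (of_nat a * (of_int k + of_int b / (2 * of_nat a))\<^sup>2))"

definition partial_theta :: "complex \<Rightarrow> nat \<Rightarrow> int \<Rightarrow> complex \<Rightarrow> complex \<Rightarrow> complex" where
  "partial_theta \<epsilon> a b u \<tau> = (\<Sum>k :: nat.
     exp (2 * of_real pi * \<epsilon> * (of_nat k + of_int b / (2 * of_nat a))) *
     cis_pow u (of_nat k + of_int b / (2 * of_nat a)) *
     cis_pow \<tau> (of_nat a * (of_nat k + of_int b / (2 * of_nat a))\<^sup>2))"

definition false_theta ::
  "nat \<Rightarrow> nat \<Rightarrow> complex \<Rightarrow> int \<Rightarrow> int \<Rightarrow> complex \<Rightarrow> complex" where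
  "false_theta pp pm \<epsilon> b c \<tau> = 1 / dedekind_eta \<tau> *
     (partial_theta (- of_real (sqrt (2 * real pp * real pm)) * \<epsilon>) (pp * pm) (b - c) 0 \<tau> -
      partial_theta (- of_real (sqrt (2 * real pp * real pm)) * \<epsilon>) (pp * pm) (b + c) 0 \<tau>)"

definition alpha_plus :: "nat \<Rightarrow> nat \<Rightarrow> real" where
  "alpha_plus pp pm = sqrt (2 * real pm / real pp)"

definition alpha_minus :: "nat \<Rightarrow> nat \<Rightarrow> real" where
  "alpha_minus pp pm = - sqrt (2 * real pp / real pm)"

definition alpha_zero :: "nat \<Rightarrow> nat \<Rightarrow> real" where
  "alpha_zero pp pm = alpha_plus pp pm + alpha_minus pp pm"

definition fock_char :: "nat \<Rightarrow> nat \<Rightarrow> complex \<Rightarrow> real \<Rightarrow> complex \<Rightarrow> complex" where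
  "fock_char pp pm \<epsilon> l \<tau> =
     exp (2 * of_real pi * \<epsilon> * of_real (l - alpha_zero pp pm / 2)) *
     cis_pow \<tau> (of_real ((l - alpha_zero pp pm / 2)\<^sup>2 / 2)) / dedekind_eta \<tau>"

definition S_kernel :: "nat \<Rightarrow> nat \<Rightarrow> complex \<Rightarrow> int \<Rightarrow> int \<Rightarrow> real \<Rightarrow> complex" where
  "S_kernel pp pm \<epsilon> b c x =
     - exp (- 2 * of_real pi * \<epsilon> * of_real x) *
     exp (2 * of_real pi * \<i> * ((of_int b - of_nat (pp * pm)) / of_real (sqrt (2 * real pp * real pm))) *
          (of_real x + \<i> * \<epsilon>)) *
     (sin (2 * of_real pi * of_int c * ((of_real x + \<i> * \<epsilon>) / of_real (sqrt (2 * real pp * real pm)))) /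
      sin (of_real pi * of_real (sqrt (2 * real pp * real pm)) * (of_real x + \<i> * \<epsilon>)))"

definition correction_term ::
  "nat \<Rightarrow> nat \<Rightarrow> complex \<Rightarrow> int \<Rightarrow> int \<Rightarrow> complex \<Rightarrow> complex" where
  "correction_term pp pm \<epsilon> b c \<tau> =
     \<i> * cis_pow \<tau> (- (\<epsilon>\<^sup>2) / 2) / of_real (sqrt (2 * real pp * real pm)) *
     (\<Sum>m<2 * pp * pm.
        exp (- of_real pi * \<i> * (of_int b * of_nat m / of_nat (pp * pm))) *
        sin (of_real pi * (of_int c * of_nat m / of_nat (pp * pm))) *
        (theta_fn (pp * pm) (int m)
           (\<i> * of_real (sqrt (2 * real pp * real pm)) * \<epsilon> * \<tau>) \<tau> / dedekind_eta \<tau>))"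

(* Pitfall: S_kernel and correction_term carry the constants with which they are printed in the
   literature.  With these normalisations the S-transformation of false_theta needs the coefficient
   - 1 in front of the integral and the coefficient 2 in front of
   (1 - sgn (Re eps)) / 2 * correction_term; the printed formula, with coefficients 1 and 1,
   is false.  For Re eps > 0, set s = sqrt (2 pp pm) and w = x + i eps.  The Gaussian integral gives
     exp (-2 pi i y^2 / (2 tau)) = sqrt (-i tau) * (integral of q^(x^2/2) exp (2 pi i x y) dx)
   with y = s k + (b -+ c) / s, and the geometric sum over k is
     1 / (1 - exp (2 pi i s w)) = i exp (- pi i s w) / (2 sin (pi s w)),
   while the difference in c contributes -2 i sin (2 pi c w / s); the product of these has sign +. *)

end

theory Submission
  imports Defs "HOL-Complex_Analysis.Complex_Analysis" "HOL-Probability.Distributions" "HOL-Library.Nat_Bijection"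
begin

text \<open>
Put \<open>s = sqrt (2 pp pm)\<close>, \<open>w = x + \<i> \<epsilon>\<close>, \<open>V = exp (2 \<pi> \<i> s w)\<close> and
\<open>y\<^sub>k = s k + d / s\<close>. Writing the two sines by exponentials, kernel times Fock character becomes
\<open>- (f (b - c) - f (b + c)) / (1 - V)\<close> up to the factor \<open>1 / \<eta> \<tau>\<close>, where
\<open>f d = exp (2 \<pi> \<i> w d / s) exp (\<pi> \<i> \<tau> x\<^sup>2)\<close> (lemma \<open>S_kernel_fock_char\<close>).

The modulus of \<open>V\<close> is the constant \<open>exp (- 2 \<pi> s Re \<epsilon>)\<close>. If \<open>Re \<epsilon> > 0\<close>, then
\<open>1 / (1 - V)\<close> is a geometric series over \<open>k \<ge> 0\<close> which may be integrated term by term, and the Gaussian integral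
turns the summand \<open>f d V\<^sup>k\<close> into the term
\<open>exp (- 2 \<pi> \<epsilon> y\<^sub>k - \<pi> \<i> y\<^sub>k\<^sup>2 / \<tau>)\<close> of a partial theta function at \<open>- 1 / \<tau>\<close>, divided
by the square root of \<open>- \<i> \<tau>\<close>. That root is the automorphy factor of the eta function
(\<open>dedekind_eta_inversion\<close>), so minus the integral is the whole answer (\<open>theta_half_sum_pos\<close>).

If \<open>Re \<epsilon> < 0\<close>, the expansion runs instead over \<open>k < 0\<close> with the opposite sign (\<open>theta_half_sum_neg\<close>). Subtracting it from
the partial theta function leaves a sum over all integers, a true theta function, to which Jacobi's inversion formula
applies (\<open>theta_full_sum\<close>). Sorting the dual sum by residues modulo \<open>2 pp pm\<close> gives the correction term
(\<open>correction_term_eq\<close>); the factor 2 is the one in \<open>2 \<i> sin r = exp (\<i> r) - exp (- \<i> r)\<close>.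

Three classical facts are proved on the way: the Gaussian integral with complex parameters, by analytic continuation from the real one;
Jacobi's inversion formula \<open>gauss_theta_inversion\<close>, by Fourier expansion of a periodised Gaussian; and the inversion of the eta function,
which becomes an instance of Jacobi's formula once Euler's pentagonal number theorem has turned the eta product into a theta series.
\<close>

section \<open>Gaussian integrals with complex parameters\<close>

text \<open>A locally dominated family of holomorphic functions has bounded difference quotients by Cauchy's estimate for the derivative,
so dominated convergence lets differentiation pass under the integral. The measure is arbitrary, hence the result covers series as well as integrals.\<close>

lemma holomorphic_on_integral:
  fixes f :: "'a \<Rightarrow> complex \<Rightarrow> complex"
  assumes S: "open S"
    and meas: "\<And>z. z \<in> S \<Longrightarrow> (\<lambda>x. f x z) \<in> borel_measurable M"
    and hol: "\<And>x. f x holomorphic_on S"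
    and bound: "\<And>z. z \<in> S \<Longrightarrow> \<exists>r>0. \<exists>g. integrable M g \<and> (\<forall>x. \<forall>y\<in>ball z r \<inter> S. norm (f x y) \<le> g x)"
  shows "(\<lambda>z. LINT x|M. f x z) holomorphic_on S"
proof -
  have "(\<lambda>z. LINT x|M. f x z) field_differentiable at z" if z: "z \<in> S" for z
  proof -
    obtain r g where r: "r > 0" and g: "integrable M g" 
      and le: "\<And>x y. y \<in> ball z r \<inter> S \<Longrightarrow> norm (f x y) \<le> g x"
      using bound[OF z] by blast
    obtain r1 where r1: "r1 > 0" "cball z r1 \<subseteq> S" using S z open_contains_cball by blast
    define R where "R = min (r/2) r1"
    have R: "R > 0" "cball z R \<subseteq> S" "cball z R \<subseteq> ball z r"
      using r r1 by (auto simp: R_def)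
    have lip: "norm (f x y - f x z) \<le> (2 * g x / R) * norm (y - z)" if y: "y \<in> ball z (R/2)" for x y
    proof (rule field_differentiable_bound[where S = "ball z (R/2)"])
      show "convex (ball z (R/2))" by simp
      show "(f x has_field_derivative deriv (f x) u) (at u within ball z (R/2))" if "u \<in> ball z (R/2)" for u
      proof -
        have "u \<in> S" using that R by (force simp: subset_iff)
        then show ?thesis using hol[of x] S holomorphic_derivI by blast
      qed
      show "norm (deriv (f x) u) \<le> 2 * g x / R" if u: "u \<in> ball z (R/2)" for u
      proof -
        have sub: "cball u (R/2) \<subseteq> cball z R"
        proof
          fix v assume "v \<in> cball u (R/2)"
          then have "dist z v \<le> dist z u + dist u v" "dist u v \<le> R/2" "dist z u < R/2"
            using u by (auto intro: dist_triangle)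
          then show "v \<in> cball z R" by simp
        qed
        have "norm ((deriv ^^ 1) (f x) u) \<le> fact 1 * g x / (R/2) ^ 1"
        proof (rule Cauchy_inequality)
          show "f x holomorphic_on ball u (R/2)"
            using holomorphic_on_subset[OF hol] sub R by (meson ball_subset_cball order_trans)
          show "continuous_on (cball u (R/2)) (f x)"
            using holomorphic_on_subset[OF hol] sub R holomorphic_on_imp_continuous_on by (meson order_trans)
          show "0 < R/2" using R by simp
          fix v assume "norm (u - v) = R/2"
          then have "v \<in> cball u (R/2)" by (simp add: dist_norm)
          then have "v \<in> ball z r \<inter> S" using sub R by blast
          then show "norm (f x v) \<le> g x" by (rule le)
        qed
        then show ?thesis by (simp add: mult_ac)
      qed
      show "y \<in> ball z (R/2)" "z \<in> ball z (R/2)" using y R by auto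
    qed
    let ?q = "\<lambda>x y. (f x y - f x z) / (y - z)"
    have qlim: "((\<lambda>y. ?q x y) \<longlongrightarrow> deriv (f x) z) (at z)" for x
      using holomorphic_derivI[OF hol S z] by (simp add: has_field_derivative_iff)
    have "((\<lambda>y. ((LINT x|M. f x y) - (LINT x|M. f x z)) / (y - z)) \<longlongrightarrow> (LINT x|M. deriv (f x) z)) (at z)"
    proof (subst tendsto_at_iff_sequentially, intro allI impI, unfold o_def)
      fix X :: "nat \<Rightarrow> complex" assume X: "\<forall>i. X i \<in> UNIV - {z}" "X \<longlonglongrightarrow> z"
      have "eventually (\<lambda>i. X i \<in> ball z (R/2)) sequentially"
        using X(2) R by (intro topological_tendstoD) auto
      then obtain n0 where n0: "\<And>i. i \<ge> n0 \<Longrightarrow> X i \<in> ball z (R/2)"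
        by (auto simp: eventually_sequentially)
      define Y where "Y i = X (i + n0)" for i
      have Y: "Y i \<in> ball z (R/2)" "Y i \<noteq> z" for i using n0 X by (auto simp: Y_def)
      have YS: "Y i \<in> S" "Y i \<in> ball z r \<inter> S" for i
      proof -
        have "Y i \<in> cball z R" using Y(1)[of i] R by (simp add: mem_ball mem_cball)
        then show "Y i \<in> S" "Y i \<in> ball z r \<inter> S" using R by auto
      qed
      have Ylim: "Y \<longlonglongrightarrow> z" unfolding Y_def by (rule LIMSEQ_ignore_initial_segment[OF X(2)])
      have lim: "(\<lambda>i. ?q x (Y i)) \<longlonglongrightarrow> deriv (f x) z" for x
        using qlim[of x, unfolded tendsto_at_iff_sequentially, rule_format, of Y] Y Ylim by (auto simp: o_def)
      have qm: "(\<lambda>x. ?q x (Y i)) \<in> borel_measurable M" for i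
        using meas[OF YS(1)] meas[OF z] by (intro borel_measurable_divide borel_measurable_diff) auto
      have int: "integrable M (\<lambda>x. f x y)" if "y \<in> ball z r \<inter> S" for y
        using that le[OF that] meas by (intro Bochner_Integration.integrable_bound[OF g]) (auto intro!: AE_I2 order_trans[OF _ abs_ge_self])
      have "(\<lambda>i. LINT x|M. ?q x (Y i)) \<longlonglongrightarrow> (LINT x|M. deriv (f x) z)"
      proof (rule integral_dominated_convergence[where w = "\<lambda>x. 2 * g x / R"])
        show "(\<lambda>x. deriv (f x) z) \<in> borel_measurable M"
          by (rule borel_measurable_LIMSEQ_metric[OF qm lim])
        show "integrable M (\<lambda>x. 2 * g x / R)" using g by simp
        show "AE x in M. (\<lambda>i. ?q x (Y i)) \<longlonglongrightarrow> deriv (f x) z" using lim by simp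
        fix i
        show "AE x in M. norm (?q x (Y i)) \<le> 2 * g x / R"
          using lip[OF Y(1)[of i]] Y(2)[of i] by (intro AE_I2) (simp add: norm_divide divide_le_eq)
      qed (rule qm)
      moreover have "(LINT x|M. ?q x (Y i)) = ((LINT x|M. f x (Y i)) - (LINT x|M. f x z)) / (Y i - z)" for i
        using int[OF YS(2)] int[of z] z r by simp
      ultimately have "(\<lambda>i. ((LINT x|M. f x (Y i)) - (LINT x|M. f x z)) / (Y i - z)) \<longlonglongrightarrow> (LINT x|M. deriv (f x) z)"
        by (simp only:)
      then show "(\<lambda>i. ((LINT x|M. f x (X i)) - (LINT x|M. f x z)) / (X i - z)) \<longlonglongrightarrow> (LINT x|M. deriv (f x) z)"
        unfolding Y_def by (rule LIMSEQ_offset)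
    qed
    then show ?thesis
      unfolding field_differentiable_def has_field_derivative_iff by blast
  qed
  then show ?thesis
    by (auto simp: holomorphic_on_def intro: field_differentiable_at_within)
qed

text \<open>Completing the square exhibits the integrand as a multiple of a normal density.\<close>

lemma gaussian_integral_real:
  fixes a b :: real assumes "a > 0"
  shows "has_bochner_integral lborel (\<lambda>x. exp (- a * x\<^sup>2 + b * x)) (sqrt (pi / a) * exp (b\<^sup>2 / (4 * a)))"
proof -
  let ?c = "sqrt (pi / a) * exp (b\<^sup>2 / (4 * a))"
  have eq: "exp (- a * x\<^sup>2 + b * x) = ?c * normal_density (b / (2*a)) (1 / sqrt (2*a)) x" for x
  proof -
    have "- a * x\<^sup>2 + b * x = b\<^sup>2 / (4 * a) + - (x - b / (2*a))\<^sup>2 / (2 * (1 / sqrt (2*a))\<^sup>2)"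
      using assms by (simp add: power_divide field_simps power2_eq_square)
    moreover have "sqrt (2 * pi * (1 / sqrt (2*a))\<^sup>2) = sqrt (pi / a)"
      using assms by (simp add: power_divide)
    ultimately show ?thesis
      using assms by (simp add: normal_density_def flip: exp_add)
  qed
  have "has_bochner_integral lborel (normal_density (b / (2*a)) (1 / sqrt (2*a))) 1"
    using assms by (simp add: has_bochner_integral_iff)
  from has_bochner_integral_mult_right[OF this, of ?c] show ?thesis
    unfolding eq by simp
qed

lemma norm_gaussian_exp:
  "norm (exp (- a * of_real x ^ 2 + b * of_real x + c)) = exp (- Re a * x\<^sup>2 + Re b * x + Re c)"
  by (simp add: norm_exp_eq_Re flip: of_real_power)

lemma integrable_gaussian_exp:
  fixes a b c :: complex assumes "Re a > 0"
  shows "integrable lborel (\<lambda>x. exp (- a * of_real x ^ 2 + b * of_real x + c))"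
proof (rule Bochner_Integration.integrable_bound)
  show "integrable lborel (\<lambda>x. exp (Re c) * exp (- Re a * x\<^sup>2 + Re b * x))"
    using gaussian_integral_real[OF assms] by (auto simp: has_bochner_integral_iff)
  show "AE x in lborel. norm (exp (- a * of_real x ^ 2 + b * of_real x + c)) \<le> norm (exp (Re c) * exp (- Re a * x\<^sup>2 + Re b * x))"
    unfolding norm_gaussian_exp by (simp add: exp_add mult_ac)
qed measurable

text \<open>First continuation: both sides are entire in \<open>b\<close> and agree on the real line.\<close>

lemma gaussian_integral_complex_linear:
  fixes a :: real and b :: complex assumes "a > 0"
  shows "(LINT x|lborel. exp (- of_real a * of_real x ^ 2 + b * of_real x)) = of_real (sqrt (pi / a)) * exp (b\<^sup>2 / (4 * of_real a))"
proof -
  define f where "f b = (LINT x|lborel. exp (- of_real a * of_real x ^ 2 + b * of_real x))" for b :: complex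
  define g where "g b = of_real (sqrt (pi / a)) * exp (b\<^sup>2 / (4 * of_real a))" for b :: complex
  have "f b - g b = 0"
  proof (rule analytic_continuation[where f = "\<lambda>b. f b - g b" and S = UNIV and U = "\<real>" and \<xi> = 0])
    have "f holomorphic_on UNIV"
      unfolding f_def
    proof (rule holomorphic_on_integral)
      fix z :: complex
      define R where "R = norm z + 1"
      show "\<exists>r>0. \<exists>g. integrable lborel g \<and> (\<forall>x::real. \<forall>y\<in>ball z r \<inter> UNIV. norm (exp (- of_real a * of_real x ^ 2 + y * of_real x)) \<le> g x)"
      proof (intro exI conjI allI ballI)
        show "integrable lborel (\<lambda>x. exp (- a * x\<^sup>2 + R * x) + exp (- a * x\<^sup>2 + (- R) * x))"
          using gaussian_integral_real[OF assms] by (intro Bochner_Integration.integrable_add) (auto simp only: has_bochner_integral_iff)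
        fix x :: real and y assume "y \<in> ball z 1 \<inter> UNIV"
        then have "\<bar>Re y\<bar> \<le> R"
          using abs_Re_le_cmod[of y] norm_triangle_ineq2[of y z] by (simp add: R_def dist_norm norm_minus_commute)
        then have "\<bar>Re y\<bar> * \<bar>x\<bar> \<le> R * \<bar>x\<bar>" by (intro mult_right_mono) auto
        then have "Re y * x \<le> R * \<bar>x\<bar>" by (metis abs_ge_self abs_mult order_trans)
        then have "Re y * x \<le> R * x \<or> Re y * x \<le> - R * x" by (auto simp: abs_if split: if_splits)
        then have "exp (- a * x\<^sup>2 + Re y * x) \<le> exp (- a * x\<^sup>2 + R * x) + exp (- a * x\<^sup>2 + (- R) * x)"
          by (auto intro: add_increasing add_increasing2)
        then show "norm (exp (- of_real a * of_real x ^ 2 + y * of_real x)) \<le> exp (- a * x\<^sup>2 + R * x) + exp (- a * x\<^sup>2 + (- R) * x)"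
          using norm_gaussian_exp[of "of_real a" x y 0] by simp
      qed simp
    qed (auto intro!: holomorphic_intros)
    moreover have "g holomorphic_on UNIV"
      unfolding g_def using assms by (auto intro!: holomorphic_intros)
    ultimately show "(\<lambda>b. f b - g b) holomorphic_on UNIV" by (intro holomorphic_intros)
    show "0 islimpt (\<real>::complex set)"
    proof (subst islimpt_approachable, intro allI impI)
      fix e :: real assume "e > 0"
      then show "\<exists>x'\<in>\<real>. x' \<noteq> 0 \<and> dist x' (0::complex) < e"
        by (intro bexI[of _ "of_real (e/2)"]) auto
    qed
    fix z :: complex assume "z \<in> \<real>"
    then obtain r where r: "z = of_real r" by (auto elim: Reals_cases)
    have "f z = (LINT x|lborel. of_real (exp (- a * x\<^sup>2 + r * x)))"
      unfolding f_def r by (intro Bochner_Integration.integral_cong) (simp_all flip: exp_of_real)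
    also have "\<dots> = of_real (sqrt (pi / a) * exp (r\<^sup>2 / (4 * a)))"
      using gaussian_integral_real[OF assms, of r] by (simp only: integral_complex_of_real has_bochner_integral_iff)
    also have "\<dots> = g z" unfolding g_def r by (simp flip: exp_of_real)
    finally show "f z - g z = 0" by simp
  qed auto
  then show ?thesis by (simp add: f_def g_def)
qed

text \<open>Second continuation: both sides are holomorphic in \<open>a\<close> on the right half-plane, where the principal square root is holomorphic,
and agree on the positive reals.\<close>

lemma gaussian_integral_complex:
  fixes a b :: complex assumes "Re a > 0"
  shows "(LINT x|lborel. exp (- (of_real pi * a) * of_real x ^ 2 + b * of_real x)) = exp (b\<^sup>2 / (4 * of_real pi * a)) / csqrt a"
proof -
  define S where "S = {a. Re a > 0}"
  define f where "f a = (LINT x|lborel. exp (- (of_real pi * a) * of_real x ^ 2 + b * of_real x))" for a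
  define g where "g a = exp (b\<^sup>2 / (4 * of_real pi * a)) / csqrt a" for a
  have "f a - g a = 0"
  proof (rule analytic_continuation[where f = "\<lambda>a. f a - g a" and S = S and U = "{a. Im a = 0 \<and> Re a > 0}" and \<xi> = 1])
    show S: "open S" unfolding S_def by (rule open_halfspace_Re_gt)
    show "connected S" unfolding S_def by (intro convex_connected convex_halfspace_Re_gt)
    have "f holomorphic_on S"
      unfolding f_def
    proof (rule holomorphic_on_integral)
      fix z :: complex assume z: "z \<in> S"
      \<comment> \<open>on the ball of radius \<open>Re z / 2\<close> the decay rate stays above half of that at the centre\<close>
      define d where "d = Re z / 2"
      have d: "d > 0" using z by (simp add: d_def S_def)
      show "\<exists>r>0. \<exists>g. integrable lborel g \<and> (\<forall>x::real. \<forall>y\<in>ball z r \<inter> S. norm (exp (- (of_real pi * y) * of_real x ^ 2 + b * of_real x)) \<le> g x)"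
      proof (intro exI conjI allI ballI)
        show "0 < d" by (fact d)
        show "integrable lborel (\<lambda>x. exp (- (pi * d) * x\<^sup>2 + Re b * x))"
          using gaussian_integral_real[of "pi * d" "Re b"] d by (simp only: has_bochner_integral_iff) simp
        fix x :: real and y assume "y \<in> ball z d \<inter> S"
        then have "d \<le> Re y"
          using abs_Re_le_cmod[of "z - y"] by (auto simp: d_def dist_norm abs_le_iff)
        then have "pi * d * x\<^sup>2 \<le> pi * Re y * x\<^sup>2" by (intro mult_right_mono mult_left_mono) auto
        then have "exp (- (pi * Re y) * x\<^sup>2 + Re b * x) \<le> exp (- (pi * d) * x\<^sup>2 + Re b * x)"
          by simp
        then show "norm (exp (- (of_real pi * y) * of_real x ^ 2 + b * of_real x)) \<le> exp (- (pi * d) * x\<^sup>2 + Re b * x)"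
          using norm_gaussian_exp[of "of_real pi * y" x b 0] by simp
      qed
    qed (use S in \<open>auto intro!: holomorphic_intros\<close>)
    moreover have "g holomorphic_on S"
      unfolding g_def by (auto intro!: holomorphic_intros simp: S_def complex_nonpos_Reals_iff)
    ultimately show "(\<lambda>a. f a - g a) holomorphic_on S" by (intro holomorphic_intros)
    show "(1::complex) islimpt {a. Im a = 0 \<and> Re a > 0}"
    proof (subst islimpt_approachable, intro allI impI)
      fix e :: real assume "e > 0"
      then show "\<exists>x'\<in>{a. Im a = 0 \<and> Re a > 0}. x' \<noteq> 1 \<and> dist x' (1::complex) < e"
        by (intro bexI[of _ "of_real (1 + e/2)"]) (auto simp: dist_norm)
    qed
    fix z :: complex assume "z \<in> {a. Im a = 0 \<and> Re a > 0}"
    then obtain r where r: "z = of_real r" "r > 0" by (metis (mono_tags) complex_is_Real_iff mem_Collect_eq of_real_Re)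
    have "f z = (LINT x|lborel. exp (- of_real (pi * r) * of_real x ^ 2 + b * of_real x))"
      unfolding f_def r by simp
    also have "\<dots> = of_real (sqrt (pi / (pi * r))) * exp (b\<^sup>2 / (4 * of_real (pi * r)))"
      by (rule gaussian_integral_complex_linear) (use r in auto)
    also have "\<dots> = g z"
      using r by (simp add: g_def csqrt_of_real real_sqrt_divide field_simps)
    finally show "f z - g z = 0" by simp
  qed (use assms in \<open>auto simp: S_def\<close>)
  then show ?thesis by (simp add: f_def g_def)
qed

section \<open>Gaussian series and periodisation\<close>

lemma exp_abs_int_summable: "(\<lambda>k::int. exp (- \<bar>real_of_int k\<bar>)) summable_on UNIV"
proof -
  have "summable (\<lambda>n::nat. exp (- real n))"
    using summable_geometric[of "exp (-1::real)"] by (simp flip: exp_of_nat_mult)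
  then have nat: "(\<lambda>n::nat. exp (- real n)) summable_on UNIV"
    by (subst summable_on_UNIV_nonneg_real_iff) auto
  have UN: "(UNIV :: int set) = range int \<union> range (\<lambda>n. - int n)"
  proof -
    have "k \<in> range int \<union> range (\<lambda>n. - int n)" for k
      by (cases k rule: int_cases2) auto
    then show ?thesis by blast
  qed
  have "(\<lambda>k::int. exp (- \<bar>real_of_int k\<bar>)) summable_on range int"
    using nat by (subst summable_on_reindex) (auto simp: o_def)
  moreover have "(\<lambda>k::int. exp (- \<bar>real_of_int k\<bar>)) summable_on range (\<lambda>n. - int n)"
    using nat by (subst summable_on_reindex) (auto simp: o_def inj_def)
  ultimately show ?thesis
    unfolding UN by (rule summable_on_union)
qed

text \<open>A quadratic decay beats any linear growth by a further \<open>\<bar>x\<bar>\<close>; it reduces the domination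
of the Gaussian series and of the periodised functions to the summability of \<open>exp (- \<bar>k\<bar>)\<close> over the integers.\<close>

lemma quadratic_le_neg_abs:
  fixes a b x :: real assumes "a > 0" "\<bar>b\<bar> \<le> B"
  shows "- a * x\<^sup>2 + b * x \<le> (B + 1)\<^sup>2 / (4 * a) - \<bar>x\<bar>"
proof -
  have "0 \<le> a * (\<bar>x\<bar> - (B + 1) / (2 * a))\<^sup>2" using assms by simp
  also have "\<dots> = a * x\<^sup>2 - (B + 1) * \<bar>x\<bar> + (B + 1)\<^sup>2 / (4 * a)"
    using assms(1) by (simp add: power2_eq_square field_simps)
  finally have "- a * x\<^sup>2 + B * \<bar>x\<bar> \<le> (B + 1)\<^sup>2 / (4 * a) - \<bar>x\<bar>" by (simp add: algebra_simps)
  moreover have "b * x \<le> B * \<bar>x\<bar>"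
  proof -
    have "b * x \<le> \<bar>b\<bar> * \<bar>x\<bar>" by (simp flip: abs_mult)
    also have "\<dots> \<le> B * \<bar>x\<bar>" using assms(2) by (intro mult_right_mono) auto
    finally show ?thesis .
  qed
  ultimately show ?thesis by linarith
qed

lemma gaussian_exp_le:
  fixes a b c :: complex assumes "Re a > 0" "norm b \<le> B" "norm c \<le> C"
  shows "norm (exp (- a * of_real x ^ 2 + b * of_real x + c)) \<le> exp ((B + 1)\<^sup>2 / (4 * Re a) + C) * exp (- \<bar>x\<bar>)"
proof -
  have "\<bar>Re b\<bar> \<le> B" "Re c \<le> C"
    using assms abs_Re_le_cmod[of b] complex_Re_le_cmod[of c] by linarith+
  with quadratic_le_neg_abs[OF assms(1), of "Re b" B x] show ?thesis
    unfolding norm_gaussian_exp by (simp flip: exp_add)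
qed

lemma gaussian_exp_summable:
  fixes a b c :: complex assumes "Re a > 0"
  shows "(\<lambda>k::int. norm (exp (- a * of_int k ^ 2 + b * of_int k + c))) summable_on UNIV"
proof (rule summable_on_comparison_test)
  show "(\<lambda>k::int. exp ((norm b + 1)\<^sup>2 / (4 * Re a) + norm c) * exp (- \<bar>real_of_int k\<bar>)) summable_on UNIV"
    by (intro summable_on_cmult_right exp_abs_int_summable)
  show "norm (exp (- a * of_int k ^ 2 + b * of_int k + c)) \<le> exp ((norm b + 1)\<^sup>2 / (4 * Re a) + norm c) * exp (- \<bar>real_of_int k\<bar>)" for k
    using gaussian_exp_le[OF assms, of b "norm b" c "norm c" "of_int k"] by simp
qed simp

text \<open>The Jacobi theta function written as a periodised Gaussian, with \<open>a = - \<i> \<tau>\<close> in terms of the usual modulus.\<close>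

definition gauss_theta :: "complex \<Rightarrow> complex \<Rightarrow> complex" where
  "gauss_theta a w = (\<Sum>\<^sub>\<infinity>k\<in>(UNIV::int set). exp (- (of_real pi * a) * (of_int k + w)\<^sup>2))"

text \<open>The constant depends on \<open>w\<close> only through the bound \<open>R\<close>: this local uniformity is what makes the theta series holomorphic in \<open>w\<close>.\<close>

lemma shifted_gaussian_le:
  fixes a w :: complex assumes "Re a > 0" "norm w \<le> R"
  shows "norm (exp (- (of_real pi * a) * (of_real x + w)\<^sup>2))
     \<le> exp ((2 * pi * norm a * R + 1)\<^sup>2 / (4 * pi * Re a) + pi * norm a * R\<^sup>2) * exp (- \<bar>x\<bar>)"
proof -
  have "- (of_real pi * a) * (of_real x + w)\<^sup>2 = - (of_real pi * a) * of_real x ^ 2 + (- 2 * of_real pi * a * w) * of_real x + - (of_real pi * a * w\<^sup>2)"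
    by (simp add: power2_eq_square algebra_simps)
  moreover have "norm (- 2 * of_real pi * a * w) \<le> 2 * pi * norm a * R"
    using assms(2) by (simp add: norm_mult mult_left_mono)
  moreover have "norm (- (of_real pi * a * w\<^sup>2)) \<le> pi * norm a * R\<^sup>2"
    using assms(2) by (simp add: norm_mult norm_power mult_left_mono power_mono)
  ultimately show ?thesis
    using gaussian_exp_le[of "of_real pi * a" "- 2 * of_real pi * a * w" "2 * pi * norm a * R" "- (of_real pi * a * w\<^sup>2)" "pi * norm a * R\<^sup>2" x] assms(1)
    by (simp add: mult_ac)
qed

lemma gauss_theta_summable:
  assumes "Re a > 0"
  shows "(\<lambda>k::int. norm (exp (- (of_real pi * a) * (of_int k + w)\<^sup>2))) summable_on UNIV"
proof (rule summable_on_comparison_test)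
  let ?C = "exp ((2 * pi * norm a * norm w + 1)\<^sup>2 / (4 * pi * Re a) + pi * norm a * (norm w)\<^sup>2)"
  show "(\<lambda>k::int. ?C * exp (- \<bar>real_of_int k\<bar>)) summable_on UNIV"
    by (intro summable_on_cmult_right exp_abs_int_summable)
  show "norm (exp (- (of_real pi * a) * (of_int k + w)\<^sup>2)) \<le> ?C * exp (- \<bar>real_of_int k\<bar>)" for k
    using shifted_gaussian_le[OF assms order_refl, of "of_int k" w] by simp
qed simp

lemma infsum_eq_integral_count_space:
  fixes f :: "'a \<Rightarrow> complex"
  assumes "(\<lambda>k. norm (f k)) summable_on A"
  shows "integrable (count_space A) f" "infsum f A = integral\<^sup>L (count_space A) f"
proof -
  have "Infinite_Set_Sum.abs_summable_on f A" using assms by (simp add: abs_summable_equivalent)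
  then show "integrable (count_space A) f" "infsum f A = integral\<^sup>L (count_space A) f"
    using infsetsum_infsum[of f A] by (simp_all add: Infinite_Set_Sum.abs_summable_on_def infsetsum_def)
qed

lemma gauss_theta_holomorphic:
  assumes "Re a > 0"
  shows "gauss_theta a holomorphic_on UNIV"
proof -
  have "(\<lambda>w. LINT k|count_space (UNIV::int set). exp (- (of_real pi * a) * (of_int k + w)\<^sup>2)) holomorphic_on UNIV"
  proof (rule holomorphic_on_integral)
    fix z :: complex
    define R where "R = norm z + 1"
    let ?C = "exp ((2 * pi * norm a * R + 1)\<^sup>2 / (4 * pi * Re a) + pi * norm a * R\<^sup>2)"
    show "\<exists>r>0. \<exists>g. integrable (count_space (UNIV::int set)) g \<and>
        (\<forall>k. \<forall>y\<in>ball z r \<inter> UNIV. norm (exp (- (of_real pi * a) * (of_int k + y)\<^sup>2)) \<le> g k)"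
    proof (intro exI conjI allI ballI)
      have "Infinite_Set_Sum.abs_summable_on (\<lambda>k::int. ?C * exp (- \<bar>real_of_int k\<bar>)) UNIV"
        by (subst abs_summable_equivalent[symmetric]) (simp add: norm_mult summable_on_cmult_right exp_abs_int_summable)
      then show "integrable (count_space (UNIV::int set)) (\<lambda>k::int. ?C * exp (- \<bar>real_of_int k\<bar>))"
        by (simp add: Infinite_Set_Sum.abs_summable_on_def)
      fix k :: int and y assume "y \<in> ball z 1 \<inter> UNIV"
      then have "norm y \<le> R"
        using norm_triangle_ineq2[of y z] by (simp add: R_def dist_norm norm_minus_commute)
      then show "norm (exp (- (of_real pi * a) * (of_int k + y)\<^sup>2)) \<le> ?C * exp (- \<bar>real_of_int k\<bar>)"
        using shifted_gaussian_le[OF assms, of y R "of_int k"] by simp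
    qed simp
  qed (auto intro!: holomorphic_intros)
  then show ?thesis
    using infsum_eq_integral_count_space(2)[OF gauss_theta_summable[OF assms]]
    by (simp add: gauss_theta_def[abs_def])
qed

text \<open>Fubini for the product of counting measure and Lebesgue measure.\<close>

lemma integral_infsum_swap:
  fixes f :: "'i::countable \<Rightarrow> real \<Rightarrow> complex"
  assumes int: "\<And>k. integrable lborel (f k)"
    and sum: "(\<lambda>k. LINT x|lborel. norm (f k x)) summable_on UNIV"
    and pw: "\<And>x. (\<lambda>k. norm (f k x)) summable_on UNIV"
  shows "integrable lborel (\<lambda>x. \<Sum>\<^sub>\<infinity>k\<in>UNIV. f k x)"
    "(LINT x|lborel. (\<Sum>\<^sub>\<infinity>k\<in>UNIV. f k x)) = (\<Sum>\<^sub>\<infinity>k\<in>UNIV. (LINT x|lborel. f k x))"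
proof -
  interpret pair_sigma_finite "count_space (UNIV :: 'i set)" "lborel :: real measure"
    by (intro pair_sigma_finite.intro sigma_finite_measure_count_space_countable sigma_finite_lborel) auto
  have prod: "integrable (count_space (UNIV :: 'i set) \<Otimes>\<^sub>M lborel) (case_prod f)"
  proof (rule Fubini_integrable)
    show "case_prod f \<in> borel_measurable (count_space (UNIV :: 'i set) \<Otimes>\<^sub>M lborel)"
      using int by (intro measurable_pair_measure_countable1) auto
    have "Infinite_Set_Sum.abs_summable_on (\<lambda>k. LINT x|lborel. norm (f k x)) UNIV"
      using sum by (subst abs_summable_equivalent[symmetric]) simp
    then show "integrable (count_space UNIV) (\<lambda>k. LINT x|lborel. norm (case_prod f (k, x)))"
      by (simp add: Infinite_Set_Sum.abs_summable_on_def)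
    show "AE k in count_space UNIV. integrable lborel (\<lambda>x. case_prod f (k, x))"
      using int by simp
  qed
  have eq: "(\<Sum>\<^sub>\<infinity>k\<in>UNIV. f k x) = (LINT k|count_space UNIV. f k x)" for x
    using infsum_eq_integral_count_space(2)[OF pw] .
  show "integrable lborel (\<lambda>x. \<Sum>\<^sub>\<infinity>k\<in>UNIV. f k x)"
    unfolding eq by (rule integrable_snd[OF prod])
  have "(\<lambda>k. norm (LINT x|lborel. f k x)) summable_on UNIV"
    by (rule summable_on_comparison_test[OF sum]) auto
  from infsum_eq_integral_count_space(2)[OF this]
  show "(LINT x|lborel. (\<Sum>\<^sub>\<infinity>k\<in>UNIV. f k x)) = (\<Sum>\<^sub>\<infinity>k\<in>UNIV. (LINT x|lborel. f k x))"
    unfolding eq by (simp add: Fubini_integral[OF prod])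
qed

text \<open>The translates of a half-open unit interval tile the line. Fubini is applied twice: to the pieces
\<open>g k\<close> of \<open>\<phi>\<close> over the tiles, and to the same pieces \<open>f k\<close> moved back to the interval around 0.\<close>

lemma integral_periodization:
  fixes \<phi> :: "real \<Rightarrow> complex"
  assumes cont: "continuous_on UNIV \<phi>" and int: "integrable lborel \<phi>"
    and le: "\<And>x. norm (\<phi> x) \<le> C * exp (- \<bar>x\<bar>)"
  shows "integral {-1/2..1/2} (\<lambda>t. \<Sum>\<^sub>\<infinity>k\<in>(UNIV::int set). \<phi> (t + of_int k)) = (LINT x|lborel. \<phi> x)"
proof -
  let ?I = "{-1/2..<1/2::real}"
  define f where "f k t = indicator ?I t *\<^sub>R \<phi> (t + of_int k)" for k :: int and t
  define g where "g k x = indicator ?I (x - of_int k) *\<^sub>R \<phi> x" for k :: int and x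
  have fg: "f k x = g k (of_int k + 1 * x)" for k x by (simp add: f_def g_def add.commute)
  have [measurable]: "\<phi> \<in> borel_measurable borel"
    using cont by (rule borel_measurable_continuous_onI)
  have intg: "integrable lborel (g k)" for k
  proof (rule Bochner_Integration.integrable_bound[OF int])
    show "g k \<in> borel_measurable lborel" unfolding g_def by measurable
    show "AE x in lborel. norm (g k x) \<le> norm (\<phi> x)" by (auto simp: g_def indicator_def)
  qed
  have intf: "integrable lborel (f k)" for k
    unfolding fg by (rule lborel_integrable_real_affine[OF intg]) simp
  have C: "C \<ge> 0"
    using le[of 0] norm_ge_zero[of "\<phi> 0"] by (simp del: norm_ge_zero)
  have nf: "norm (f k t) \<le> C * exp 1 * exp (- \<bar>of_int k\<bar>) * indicator ?I t" for k t
  proof (cases "t \<in> ?I")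
    case True
    then have "norm (f k t) \<le> C * exp (- \<bar>t + of_int k\<bar>)" using le by (simp add: f_def)
    also have "\<dots> \<le> C * exp (1 - \<bar>of_int k\<bar>)" using True C by (intro mult_left_mono) auto
    finally show ?thesis using True by (simp add: exp_diff exp_minus field_simps)
  qed (simp add: f_def)
  have Nf: "(LINT t|lborel. norm (f k t)) \<le> C * exp 1 * exp (- \<bar>of_int k\<bar>)" for k
  proof -
    have "(LINT t|lborel. norm (f k t)) \<le> (LINT t|lborel. C * exp 1 * exp (- \<bar>of_int k\<bar>) * indicator ?I t)"
      using nf intf by (intro integral_mono) auto
    then show ?thesis by simp
  qed
  have sumk: "(\<lambda>k::int. C * exp 1 * exp (- \<bar>real_of_int k\<bar>)) summable_on UNIV"
    by (intro summable_on_cmult_right exp_abs_int_summable)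
  have sumf: "(\<lambda>k. LINT t|lborel. norm (f k t)) summable_on UNIV"
    by (rule summable_on_comparison_test[OF sumk]) (auto simp: Nf)
  have Ng: "(LINT x|lborel. norm (g k x)) = (LINT t|lborel. norm (f k t))" for k
    using lborel_integral_real_affine[of 1 "\<lambda>x. norm (g k x)" "of_int k"] by (simp add: fg)
  have Ig: "(LINT x|lborel. g k x) = (LINT t|lborel. f k t)" for k
    using lborel_integral_real_affine[of 1 "\<lambda>x. g k x" "of_int k"] by (simp add: fg)
  have g_neutral: "g k x = 0" if "k \<noteq> \<lfloor>x + 1/2\<rfloor>" for k x
  proof -
    have "x - of_int k \<notin> ?I" using that by (auto simp: floor_eq_iff) linarith
    then show ?thesis by (simp add: g_def)
  qed
  have g_self: "g \<lfloor>x + 1/2\<rfloor> x = \<phi> x" for x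
  proof -
    have "x - of_int \<lfloor>x + 1/2\<rfloor> \<in> ?I" by simp linarith
    then show ?thesis by (simp add: g_def)
  qed
  have g_sum: "((\<lambda>k. g k x) has_sum \<phi> x) UNIV" for x
    by (rule has_sum_finite_neutralI[where B = "{\<lfloor>x + 1/2\<rfloor>}"]) (auto simp: g_neutral g_self)
  have g_nsum: "(\<lambda>k. norm (g k x)) summable_on UNIV" for x
    by (rule has_sum_imp_summable, rule has_sum_finite_neutralI[where B = "{\<lfloor>x + 1/2\<rfloor>}", OF _ _ _ refl])
      (auto simp: g_neutral)
  have f_nsum: "(\<lambda>k. norm (f k t)) summable_on UNIV" for t
    by (rule summable_on_comparison_test[OF summable_on_cmult_left[OF sumk, of "indicator ?I t"]]) (rule nf norm_ge_zero)+
  note sw_f = integral_infsum_swap[OF intf sumf f_nsum]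
  note sw_g = integral_infsum_swap(2)[OF intg _ g_nsum, unfolded Ng, OF sumf]
  have f_inf: "(\<Sum>\<^sub>\<infinity>k\<in>UNIV. f k t) = indicator ?I t *\<^sub>R (\<Sum>\<^sub>\<infinity>k\<in>(UNIV::int set). \<phi> (t + of_int k))" for t
    by (cases "t \<in> ?I") (auto simp: f_def)
  have "(LINT x|lborel. \<phi> x) = (LINT t|lborel. indicator ?I t *\<^sub>R (\<Sum>\<^sub>\<infinity>k\<in>(UNIV::int set). \<phi> (t + of_int k)))"
    using sw_g sw_f(2) infsumI[OF g_sum] by (simp add: Ig f_inf)
  also have "\<dots> = integral ?I (\<lambda>t. \<Sum>\<^sub>\<infinity>k\<in>(UNIV::int set). \<phi> (t + of_int k))"
    using set_borel_integral_eq_integral(2)[of ?I "\<lambda>t. \<Sum>\<^sub>\<infinity>k\<in>(UNIV::int set). \<phi> (t + of_int k)"] sw_f(1)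
    unfolding set_integrable_def set_lebesgue_integral_def f_inf by blast
  also have "\<dots> = integral {-1/2..1/2} (\<lambda>t. \<Sum>\<^sub>\<infinity>k\<in>(UNIV::int set). \<phi> (t + of_int k))"
    by (rule integral_spike_set; rule negligible_subset[OF negligible_sing[of "1/2"]]) auto
  finally show ?thesis by simp
qed

section \<open>Pointwise convergence of Fourier series and Jacobi inversion\<close>

text \<open>Links unconditional sums over the integers with the telescoping partial sums used for Fourier series and for the pentagonal numbers.\<close>

lemma symmetric_partial_sums_tendsto:
  fixes f :: "int \<Rightarrow> complex"
  assumes "(f has_sum S) UNIV"
  shows "(\<lambda>M::nat. \<Sum>n=-int M..int M. f n) \<longlonglongrightarrow> S"
proof -
  have "filterlim (\<lambda>M::nat. {-int M..int M}) (finite_subsets_at_top UNIV) sequentially"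
  proof (subst filterlim_finite_subsets_at_top, intro allI impI)
    fix X :: "int set" assume X: "finite X \<and> X \<subseteq> UNIV"
    have "\<exists>B. \<forall>k\<in>X. \<bar>k\<bar> \<le> B"
      using X finite_nat_set_iff_bounded_le[of "nat ` abs ` X"] by (auto intro!: exI[of _ "Max (abs ` X)"])
    then obtain B where B: "\<And>k. k \<in> X \<Longrightarrow> \<bar>k\<bar> \<le> B" by blast
    have "X \<subseteq> {-int M..int M}" if "M \<ge> nat B" for M using that B by force
    then show "\<forall>\<^sub>F M in sequentially. finite {-int M..int M} \<and> X \<subseteq> {-int M..int M} \<and> {-int M..int M} \<subseteq> UNIV"
      by (auto simp: eventually_sequentially intro!: exI[of _ "nat B"])
  qed
  with assms show ?thesis
    unfolding has_sum_def by (rule filterlim_compose)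
qed

text \<open>The Riemann-Lebesgue lemma for continuously differentiable functions, with the rate that one integration by parts gives.\<close>

lemma oscillating_integral_bound:
  fixes h h' :: "real \<Rightarrow> complex"
  assumes ab: "a \<le> b"
    and der: "\<And>t. t \<in> {a..b} \<Longrightarrow> (h has_vector_derivative h' t) (at t within {a..b})"
    and cont: "continuous_on {a..b} h'"
  shows "\<exists>C. \<forall>n::int. n \<noteq> 0 \<longrightarrow> norm (integral {a..b} (\<lambda>t. h t * exp (2 * of_real pi * \<i> * of_int n * of_real t))) \<le> C / \<bar>of_int n\<bar>"
proof -
  let ?e = "\<lambda>n t. exp (2 * of_real pi * \<i> * of_int n * of_real t) :: complex"
  have conth: "continuous_on {a..b} h"
    using der by (rule continuous_on_vector_derivative)
  obtain A where "\<forall>y\<in>h ` {a..b}. norm y \<le> A"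
    using compact_imp_bounded[OF compact_continuous_image[OF conth compact_Icc]] unfolding bounded_iff by blast
  then have A: "\<And>t. t \<in> {a..b} \<Longrightarrow> norm (h t) \<le> A" by blast
  obtain B where "\<forall>y\<in>h' ` {a..b}. norm y \<le> B"
    using compact_imp_bounded[OF compact_continuous_image[OF cont compact_Icc]] unfolding bounded_iff by blast
  then have B: "\<And>t. t \<in> {a..b} \<Longrightarrow> norm (h' t) \<le> B" by blast
  show ?thesis
  proof (intro exI[of _ "2 * A + B * (b - a)"] allI impI)
    fix n :: int assume n: "n \<noteq> 0"
    have en: "norm (?e n t) = 1" for t by (simp add: norm_exp_eq_Re)
    let ?F = "\<lambda>t. h t * ?e n t"
    let ?c = "2 * of_real pi * \<i> * of_int n :: complex"
    have ed: "(?e n has_vector_derivative (?c * ?e n t)) (at t within {a..b})" for t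
    proof -
      have "((\<lambda>z. exp (?c * z)) has_field_derivative (?c * exp (?c * of_real t))) (at (of_real t))"
        by (auto intro!: derivative_eq_intros)
      from has_vector_derivative_real_field[OF this] show ?thesis by simp
    qed
    have "(?F has_vector_derivative (h t * (?c * ?e n t) + h' t * ?e n t)) (at t within {a..b})" if "t \<in> {a..b}" for t
      by (rule has_vector_derivative_mult[OF der[OF that] ed])
    then have "((\<lambda>t. h t * (?c * ?e n t) + h' t * ?e n t) has_integral (?F b - ?F a)) {a..b}"
      by (rule fundamental_theorem_of_calculus[OF ab])
    moreover
    have i1: "(\<lambda>t. h t * ?e n t) integrable_on {a..b}" and i2: "(\<lambda>t. h' t * ?e n t) integrable_on {a..b}"
      using conth cont by (auto intro!: integrable_continuous_real continuous_intros)
    have "((\<lambda>t. ?c * (h t * ?e n t) + h' t * ?e n t) has_integral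
       (?c * integral {a..b} (\<lambda>t. h t * ?e n t) + integral {a..b} (\<lambda>t. h' t * ?e n t))) {a..b}"
      using i1 i2 by (intro has_integral_add has_integral_mult_right integrable_integral)
    ultimately have "?c * integral {a..b} (\<lambda>t. h t * ?e n t) = ?F b - ?F a - integral {a..b} (\<lambda>t. h' t * ?e n t)"
      by (auto dest: has_integral_unique simp: algebra_simps)
    moreover have "norm (x - y - z) \<le> norm x + norm y + norm z" for x y z :: complex
      using norm_triangle_ineq4[of "x - y" z] norm_triangle_ineq4[of x y] by linarith
    ultimately have "norm (?c * integral {a..b} (\<lambda>t. h t * ?e n t)) \<le> norm (?F b) + norm (?F a) + norm (integral {a..b} (\<lambda>t. h' t * ?e n t))"
      by (simp only:)
    also have "\<dots> \<le> A + A + B * (b - a)"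
    proof (intro add_mono)
      show "norm (integral {a..b} (\<lambda>t. h' t * ?e n t)) \<le> B * (b - a)"
        using B cont ab by (intro integral_bound continuous_intros) (auto simp: norm_mult en)
    qed (use A ab in \<open>auto simp: norm_mult en\<close>)
    finally have 1: "2 * pi * \<bar>of_int n\<bar> * norm (integral {a..b} (\<lambda>t. h t * ?e n t)) \<le> 2 * A + B * (b - a)"
      by (simp add: norm_mult)
    have "1 * (\<bar>of_int n\<bar> * norm (integral {a..b} (\<lambda>t. h t * ?e n t))) \<le> (2 * pi) * (\<bar>of_int n\<bar> * norm (integral {a..b} (\<lambda>t. h t * ?e n t)))"
      using pi_ge_two by (intro mult_right_mono) auto
    with 1 have "\<bar>of_int n\<bar> * norm (integral {a..b} (\<lambda>t. h t * ?e n t)) \<le> 2 * A + B * (b - a)"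
      by (simp add: mult_ac)
    then show "norm (integral {a..b} (\<lambda>t. h t * ?e n t)) \<le> (2 * A + B * (b - a)) / \<bar>of_int n\<bar>"
      using n by (simp add: pos_le_divide_eq mult.commute)
  qed
qed

lemma exp_2pi_i_int [simp]: "exp (2 * of_real pi * \<i> * of_int n) = (1::complex)"
  using exp_integer_2pi[of "of_int n"] by (simp add: mult_ac)

lemma integral_exp_period:
  "integral {-1/2..1/2} (\<lambda>t. exp (2 * of_real pi * \<i> * of_int n * of_real t)) = (if n = 0 then 1 else 0 :: complex)"
proof (cases "n = 0")
  case False
  let ?c = "2 * of_real pi * \<i> * of_int n :: complex"
  have c: "?c \<noteq> 0" using False by simp
  have "((\<lambda>t. exp (?c * of_real t)) has_integral (exp (?c * of_real (1/2)) / ?c - exp (?c * of_real (-1/2)) / ?c)) {-1/2..1/2}"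
  proof (rule fundamental_theorem_of_calculus)
    fix t :: real
    have "((\<lambda>z. exp (?c * z) / ?c) has_field_derivative exp (?c * of_real t)) (at (of_real t))"
      using c by (auto intro!: derivative_eq_intros)
    from has_vector_derivative_real_field[OF this]
    show "((\<lambda>t. exp (?c * of_real t) / ?c) has_vector_derivative exp (?c * of_real t)) (at t within {-1/2..1/2})"
      by simp
  qed simp
  moreover have "?c * of_real (1/2) = ?c * of_real (-1/2) + ?c" by simp
  then have "exp (?c * of_real (1/2)) = exp (?c * of_real (-1/2)) * exp ?c" by (simp only: exp_add)
  then have "exp (?c * of_real (1/2)) = exp (?c * of_real (-1/2))" by (simp only: exp_2pi_i_int mult_1_right)
  ultimately show ?thesis using False by (auto dest: integral_unique)
qed simp

text \<open>Chernoff's proof that a Fourier series converges to the function. With \<open>e z = exp (2 \<pi> \<i> z)\<close>, the quotient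
\<open>H z = (G z - G 0) / (e z - 1)\<close> extends holomorphically over 0 and has no other pole with \<open>\<bar>Re z\<bar> < 1\<close>. If \<open>d n\<close> are the Fourier
coefficients of \<open>H\<close>, then \<open>G = G 0 + (e - 1) H\<close> says that those of \<open>G\<close> are \<open>d (n + 1) - d n\<close>, plus \<open>G 0\<close> for \<open>n = 0\<close>. Their
sum telescopes to \<open>G 0\<close>, as \<open>d n\<close> tends to 0 in both directions.\<close>

lemma fourier_series_at_0:
  fixes G :: "complex \<Rightarrow> complex"
  assumes hol: "G holomorphic_on UNIV"
    and c: "((\<lambda>n::int. integral {-1/2..1/2} (\<lambda>t. G (of_real t) * exp (2 * of_real pi * \<i> * of_int n * of_real t))) has_sum S) UNIV"
  shows "S = G 0"
proof -
  define e where "e z = exp (2 * of_real pi * \<i> * z)" for z :: complex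
  define c where "c n = integral {-1/2..1/2} (\<lambda>t. G (of_real t) * exp (2 * of_real pi * \<i> * of_int n * of_real t))" for n :: int
  define g1 where "g1 z = (if z = 0 then deriv G 0 else (G z - G 0) / (z - 0))" for z
  define e1 where "e1 z = (if z = 0 then deriv e 0 else (e z - e 0) / (z - 0))" for z
  define H where "H z = g1 z / e1 z" for z
  let ?T = "{z. \<bar>Re z\<bar> < 1}"
  have g1: "g1 holomorphic_on UNIV" unfolding g1_def by (rule pole_lemma_open[OF hol]) simp
  have ehol: "e holomorphic_on UNIV" unfolding e_def by (intro holomorphic_intros)
  have e1: "e1 holomorphic_on UNIV" unfolding e1_def by (rule pole_lemma_open[OF ehol]) simp
  have de: "deriv e 0 = 2 * of_real pi * \<i>"
    unfolding e_def by (rule DERIV_imp_deriv) (auto intro!: derivative_eq_intros)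
  have e1_nz: "e1 z \<noteq> 0" if "z \<in> ?T" for z
  proof (cases "z = 0")
    case False
    have "e z \<noteq> 1"
    proof
      assume "e z = 1"
      then obtain n :: int where "Im (2 * of_real pi * \<i> * z) = of_int (2 * n) * pi" "Re (2 * of_real pi * \<i> * z) = 0"
        unfolding e_def exp_eq_1 by blast
      then have "Re z = of_int n" "Im z = 0" by auto
      with that False show False by (auto simp: complex_eq_iff)
    qed
    with False show ?thesis by (simp add: e1_def e_def)
  qed (simp add: e1_def de)
  have opT: "open ?T"
  proof -
    have "?T = {z. Re z < 1} \<inter> {z. Re z > -1}" by auto
    then show ?thesis using open_halfspace_Re_lt[of 1] open_halfspace_Re_gt[of "-1"] by auto
  qed
  have Hhol: "H holomorphic_on ?T"
    unfolding H_def using holomorphic_on_subset[OF g1] holomorphic_on_subset[OF e1] e1_nz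
    by (intro holomorphic_on_divide) auto
  have GH: "G z = G 0 + (e z - 1) * H z" if "z \<in> ?T" for z
    using e1_nz[OF that] by (cases "z = 0") (auto simp: H_def g1_def e1_def e_def)
  let ?I = "{-1/2..1/2::real}"
  have IT: "of_real t \<in> ?T" if "t \<in> ?I" for t using that by auto
  define d where "d n = integral ?I (\<lambda>t. H (of_real t) * exp (2 * of_real pi * \<i> * of_int n * of_real t))" for n :: int
  have Hder: "((\<lambda>t. H (of_real t)) has_vector_derivative deriv H (of_real t)) (at t within ?I)" if "t \<in> ?I" for t
    using holomorphic_derivI[OF Hhol opT IT[OF that]] has_vector_derivative_real_field by blast
  have contd: "continuous_on ?I (\<lambda>t. deriv H (of_real t))"
  proof (rule continuous_on_compose2[where g = "deriv H"])
    show "continuous_on ?T (deriv H)"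
      by (intro holomorphic_on_imp_continuous_on holomorphic_deriv Hhol opT)
  qed (use IT in \<open>auto intro!: continuous_intros\<close>)
  have contH: "continuous_on ?I (\<lambda>t. H (of_real t))"
    using Hder by (rule continuous_on_vector_derivative)
  obtain C where C: "\<And>n::int. n \<noteq> 0 \<Longrightarrow> norm (d n) \<le> C / \<bar>of_int n\<bar>"
    unfolding d_def using oscillating_integral_bound[OF _ Hder contd] by auto
  have c_eq: "c n = (if n = 0 then G 0 else 0) + d (n + 1) - d n" for n
  proof -
    define E where "E n t = exp (2 * of_real pi * \<i> * of_int n * of_real t)" for n :: int and t :: real
    have int: "(\<lambda>t. H (of_real t) * E n t) integrable_on ?I" for n
      unfolding E_def by (intro integrable_continuous_real continuous_intros contH)
    have eint: "E n integrable_on ?I" unfolding E_def by (intro integrable_continuous_real continuous_intros)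
    have "c n = integral ?I (\<lambda>t. G 0 * E n t + H (of_real t) * E (n + 1) t - H (of_real t) * E n t)"
      unfolding c_def E_def[symmetric]
    proof (rule integral_cong)
      fix t assume "t \<in> ?I"
      then have hG: "G (of_real t) = G 0 + (e (of_real t) - 1) * H (of_real t)" using GH IT by blast
      have hE: "e (of_real t) * E n t = E (n + 1) t"
        unfolding e_def E_def exp_add[symmetric] by (simp add: algebra_simps)
      show "G (of_real t) * E n t = G 0 * E n t + H (of_real t) * E (n + 1) t - H (of_real t) * E n t"
        unfolding hG hE[symmetric] by (simp add: algebra_simps)
    qed
    also have "\<dots> = G 0 * integral ?I (E n) + d (n + 1) - d n"
      unfolding d_def E_def[symmetric]
      by (rule integral_unique, intro has_integral_add has_integral_diff has_integral_mult_right integrable_integral int eint)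
    finally show ?thesis using integral_exp_period[of n, folded E_def] by simp
  qed
  have tele: "(\<Sum>n=-int M..int M. c n) = G 0 + d (int M + 1) - d (- int M)" for M
  proof (induction M)
    case (Suc M)
    have "{-int (Suc M)..int (Suc M)} = insert (- int (Suc M)) (insert (int (Suc M)) {-int M..int M})" by auto
    with Suc show ?case by (simp add: c_eq algebra_simps)
  qed (simp add: c_eq)
  have lim0: "(\<lambda>M::nat. C / (real M)) \<longlonglongrightarrow> 0" by (rule lim_const_over_n)
  have "(\<lambda>M. d (int M + 1)) \<longlonglongrightarrow> 0"
  proof (rule Lim_null_comparison)
    show "\<forall>\<^sub>F M in sequentially. norm (d (int M + 1)) \<le> C / real (Suc M)"
      using C[of "int _ + 1"] by (intro always_eventually allI) (simp add: add.commute)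
    show "(\<lambda>M. C / real (Suc M)) \<longlonglongrightarrow> 0" using lim0 by (rule LIMSEQ_Suc)
  qed
  moreover have "(\<lambda>M. d (- int M)) \<longlonglongrightarrow> 0"
  proof (rule Lim_null_comparison[OF _ lim0])
    show "\<forall>\<^sub>F M in sequentially. norm (d (- int M)) \<le> C / real M"
      using C[of "- int _"] by (auto simp: eventually_sequentially intro!: exI[of _ 1])
  qed
  ultimately have "(\<lambda>M. G 0 + d (int M + 1) - d (- int M)) \<longlonglongrightarrow> G 0 + 0 - 0"
    by (intro tendsto_intros)
  then have "(\<lambda>M. \<Sum>n=-int M..int M. c n) \<longlonglongrightarrow> G 0" by (simp add: tele)
  with symmetric_partial_sums_tendsto[OF c] show ?thesis
    unfolding c_def by (rule LIMSEQ_unique)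
qed

text \<open>Poisson summation for the Gaussian: the Fourier coefficients of \<open>t \<mapsto> gauss_theta a (w + t)\<close> unfold to Gaussian integrals over
the whole line, and the Fourier series is evaluated at \<open>t = 0\<close>.\<close>

theorem gauss_theta_inversion:
  assumes a: "Re a > 0"
  shows "((\<lambda>n::int. exp (- of_real pi * of_int n ^ 2 / a + 2 * of_real pi * \<i> * of_int n * w)) has_sum (csqrt a * gauss_theta a w)) UNIV"
proof -
  define G where "G z = gauss_theta a (w + z)" for z
  define c where "c n = integral {-1/2..1/2} (\<lambda>t. G (of_real t) * exp (2 * of_real pi * \<i> * of_int n * of_real t))" for n :: int
  define T where "T n = exp (- of_real pi * of_int n ^ 2 / a + 2 * of_real pi * \<i> * of_int n * w)" for n :: int
  have a0: "a \<noteq> 0" using a by auto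
  have hol: "G holomorphic_on UNIV"
    unfolding G_def
    by (rule holomorphic_on_compose_gen[OF _ gauss_theta_holomorphic[OF a], unfolded o_def])
       (auto intro!: holomorphic_intros)
  have c: "c n = T (- n) / csqrt a" for n
  proof -
    \<comment> \<open>the linear coefficient of the shifted Gaussian times the \<open>n\<close>-th character\<close>
    define b where "b = 2 * of_real pi * (\<i> * of_int n - a * w)"
    define \<phi> where "\<phi> x = exp (- (of_real pi * a) * of_real x ^ 2 + b * of_real x + - (of_real pi * a * w\<^sup>2))" for x :: real
    have \<phi>: "\<phi> x = exp (- (of_real pi * a) * (of_real x + w)\<^sup>2) * exp (2 * of_real pi * \<i> * of_int n * of_real x)" for x
      unfolding \<phi>_def b_def by (simp add: power2_eq_square algebra_simps flip: exp_add)
    have \<phi>k: "\<phi> (t + of_int k) = exp (- (of_real pi * a) * (of_int k + (w + of_real t))\<^sup>2) * exp (2 * of_real pi * \<i> * of_int n * of_real t)" for t k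
    proof -
      have "exp (2 * of_real pi * \<i> * of_int n * of_real (t + of_int k)) = exp (2 * of_real pi * \<i> * of_int n * of_real t) * exp (2 * of_real pi * \<i> * of_int (n * k))"
        unfolding exp_add[symmetric] by (simp add: algebra_simps)
      then show ?thesis unfolding \<phi> exp_2pi_i_int by (simp add: add_ac)
    qed
    have pa: "Re (of_real pi * a) > 0" using a by simp
    have "c n = integral {-1/2..1/2} (\<lambda>t. \<Sum>\<^sub>\<infinity>k\<in>(UNIV::int set). \<phi> (t + of_int k))"
      unfolding c_def \<phi>k G_def gauss_theta_def by (simp add: infsum_cmult_left')
    also have "\<dots> = (LINT x|lborel. \<phi> x)"
    proof (rule integral_periodization)
      show "continuous_on UNIV \<phi>" unfolding \<phi>_def by (intro continuous_intros)
      show "integrable lborel \<phi>" unfolding \<phi>_def by (rule integrable_gaussian_exp[OF pa])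
      show "norm (\<phi> x) \<le> exp ((norm b + 1)\<^sup>2 / (4 * Re (of_real pi * a)) + norm (- (of_real pi * a * w\<^sup>2))) * exp (- \<bar>x\<bar>)" for x
        unfolding \<phi>_def by (rule gaussian_exp_le[OF pa order_refl order_refl])
    qed
    also have "\<dots> = (LINT x|lborel. exp (- (of_real pi * a) * of_real x ^ 2 + b * of_real x)) * exp (- (of_real pi * a * w\<^sup>2))"
      unfolding \<phi>_def exp_add[of _ "- (of_real pi * a * w\<^sup>2)"] by simp
    also have "\<dots> = exp (b\<^sup>2 / (4 * of_real pi * a) - of_real pi * a * w\<^sup>2) / csqrt a"
      unfolding gaussian_integral_complex[OF a]
      by (simp only: exp_add[symmetric] diff_conv_add_uminus times_divide_eq_left)
    also have "b\<^sup>2 / (4 * of_real pi * a) - of_real pi * a * w\<^sup>2 = - of_real pi * of_int (-n) ^ 2 / a + 2 * of_real pi * \<i> * of_int (-n) * w"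
      using a0 by (simp add: b_def field_simps power2_eq_square)
    finally show ?thesis by (simp add: T_def)
  qed
  have "Re (of_real pi / a) > 0" using a a0 by (simp add: Re_divide power2_eq_square add_pos_nonneg sum_squares_gt_zero_iff complex_neq_0)
  from gaussian_exp_summable[OF this, of "2 * of_real pi * \<i> * w" 0]
  have "(\<lambda>n. norm (T n)) summable_on UNIV"
    unfolding T_def by (simp add: mult_ac)
  then have "T summable_on UNIV" by (rule abs_summable_summable)
  then obtain S where S: "(T has_sum S) UNIV" by (auto simp: summable_on_def)
  have "((\<lambda>n. T (- n)) has_sum S) UNIV"
    using S has_sum_reindex_bij_betw[OF bij_uminus, of T S] by simp
  then have "(c has_sum (S / csqrt a)) UNIV"
    unfolding c by (rule has_sum_divide_const)
  from fourier_series_at_0[OF hol this[unfolded c_def]] have "S = csqrt a * gauss_theta a w"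
    using a0 by (simp add: G_def field_simps)
  with S show ?thesis by (simp add: T_def[abs_def])
qed

section \<open>The pentagonal number theorem and the Dedekind eta function\<close>

lemma two_triangle: "2 * triangle n = n * (n + 1)"
  by (simp add: triangle_def)

text \<open>Shanks' finite form of the pentagonal number theorem. When \<open>n\<close> grows by one, the change of the \<open>s\<close>-th summand on the left is
a difference \<open>h (Suc s) - h s\<close>, so that only one boundary term and the new summand remain; these are the two new powers on the right.\<close>

lemma shanks_identity:
  fixes q :: "'a::comm_ring_1"
  shows "(\<Sum>s\<le>n. (-1) ^ s * (\<Prod>k\<in>{s<..n}. 1 - q ^ k) * q ^ (triangle s + s * n))
       = 1 + (\<Sum>j=1..n. (-1) ^ j * (q ^ (triangle j + j * j) + q ^ (triangle j + j * (j - 1))))"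
proof (induction n)
  case (Suc n)
  let ?R = "\<lambda>s n. \<Prod>k\<in>{s<..n}. 1 - q ^ k"
  let ?F = "\<lambda>n s. (-1) ^ s * ?R s n * q ^ (triangle s + s * n)"
  define h where "h s = (if s = 0 then 0 else (-1) ^ s * ?R (s - 1) n * q ^ (triangle s + s * n))" for s
  have diff: "?F (Suc n) s - ?F n s = h (Suc s) - h s" if "s \<le> n" for s
  proof -
    define X where "X = (-1) ^ s * ?R s n * q ^ (triangle s + s * n)"
    have "{s<..Suc n} = insert (Suc n) {s<..n}" using that by auto
    then have R1: "?R s (Suc n) = (1 - q ^ Suc n) * ?R s n" by simp
    have F1: "?F (Suc n) s = X * (q ^ s - q ^ (s + Suc n))"
      unfolding R1 X_def by (simp add: algebra_simps power_add)
    have h1: "h (Suc s) = - X * q ^ (s + Suc n)"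
      unfolding h_def X_def by (simp add: triangle_Suc algebra_simps power_add)
    have h0: "h s = X * (1 - q ^ s)"
    proof (cases s)
      case (Suc s')
      have "{s - 1<..n} = insert s {s<..n}" using that Suc by auto
      then have R0: "?R (s - 1) n = (1 - q ^ s) * ?R s n" by simp
      have "h s = (-1) ^ s * ?R (s - 1) n * q ^ (triangle s + s * n)"
        using Suc by (simp add: h_def)
      then show ?thesis unfolding R0 X_def by (simp only: mult_ac)
    qed (simp add: h_def)
    show ?thesis unfolding F1 h1 h0 X_def[symmetric] by (simp add: algebra_simps)
  qed
  have "(\<Sum>s\<le>n. ?F (Suc n) s) - (\<Sum>s\<le>n. ?F n s) = (\<Sum>s\<le>n. h (Suc s) - h s)"
    unfolding sum_subtractf[symmetric] by (intro sum.cong diff) auto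
  also have "\<dots> = h (Suc n)"
    unfolding lessThan_Suc_atMost[symmetric] sum_lessThan_telescope by (simp add: h_def)
  also have "\<dots> = (-1) ^ Suc n * q ^ (triangle (Suc n) + Suc n * n)"
    by (simp add: h_def)
  finally show ?case
    using Suc by (simp add: algebra_simps)
qed simp

text \<open>A bound uniform in both ends of the product, so that the powers of \<open>q\<close> alone decide which summands of Shanks' identity survive in the limit.\<close>

lemma norm_one_minus_prod_le:
  fixes q :: complex assumes "norm q < 1"
  shows "norm (\<Prod>k\<in>{s<..n}. 1 - q ^ k) \<le> exp (1 / (1 - norm q))"
proof -
  have "norm (\<Prod>k\<in>{s<..n}. 1 - q ^ k) \<le> (\<Prod>k\<in>{s<..n}. exp (norm q ^ k))"
    unfolding prod_norm[symmetric]
  proof (intro prod_mono conjI)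
    fix k
    have "norm (1 - q ^ k) \<le> 1 + norm q ^ k" using norm_triangle_ineq4[of 1 "q ^ k"] by (simp add: norm_power)
    also have "\<dots> \<le> exp (norm q ^ k)" by (rule exp_ge_add_one_self)
    finally show "norm (1 - q ^ k) \<le> exp (norm q ^ k)" .
  qed simp
  also have "\<dots> = exp (\<Sum>k\<in>{s<..n}. norm q ^ k)" by (simp add: exp_sum)
  also have "(\<Sum>k\<in>{s<..n}. norm q ^ k) \<le> (\<Sum>k. norm q ^ k)"
    using assms by (intro sum_le_suminf summable_geometric) auto
  also have "(\<Sum>k. norm q ^ k) = 1 / (1 - norm q)" using assms by (intro suminf_geometric) auto
  finally show ?thesis by simp
qed

text \<open>In Shanks' identity every summand with \<open>s \<ge> 1\<close> carries a power of \<open>q\<close> with exponent at least \<open>n\<close>, so the \<open>n\<close> of them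
vanish together in the limit; the summand \<open>s = 0\<close> is the partial product.\<close>

theorem pentagonal_number_theorem:
  fixes q :: complex assumes q: "norm q < 1"
  shows "(\<lambda>n. 1 + (\<Sum>j=1..n. (-1) ^ j * (q ^ (triangle j + j * j) + q ^ (triangle j + j * (j - 1))))) \<longlonglongrightarrow> (\<Prod>n. 1 - q ^ Suc n)"
proof -
  let ?R = "\<lambda>s n. \<Prod>k\<in>{s<..n}. 1 - q ^ k"
  let ?F = "\<lambda>n s. (-1) ^ s * ?R s n * q ^ (triangle s + s * n)"
  define C where "C = exp (1 / (1 - norm q))"
  have "summable (\<lambda>n. norm ((1 - q ^ Suc n) - 1))"
    using q by (simp add: norm_power norm_mult summable_mult summable_geometric)
  then have "convergent_prod (\<lambda>n. 1 - q ^ Suc n)"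
    by (intro abs_convergent_prod_imp_convergent_prod summable_imp_abs_convergent_prod)
  then have "(\<lambda>n. \<Prod>i\<le>n. 1 - q ^ Suc i) \<longlonglongrightarrow> (\<Prod>n. 1 - q ^ Suc n)"
    by (rule convergent_prod_LIMSEQ)
  moreover have "(\<Prod>i\<le>n. 1 - q ^ Suc i) = ?R 0 (Suc n)" for n
    by (rule prod.reindex_bij_witness[of _ "\<lambda>k. k - 1" Suc]) auto
  ultimately have "(\<lambda>n. ?R 0 (Suc n)) \<longlonglongrightarrow> (\<Prod>n. 1 - q ^ Suc n)"
    by (simp only:)
  then have P: "(\<lambda>n. ?R 0 n) \<longlonglongrightarrow> (\<Prod>n. 1 - q ^ Suc n)"
    by (rule LIMSEQ_imp_Suc)
  have "(\<lambda>n. \<Sum>s=1..n. ?F n s) \<longlonglongrightarrow> 0"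
  proof (rule Lim_null_comparison)
    show "(\<lambda>n. C * (real n * norm q ^ n)) \<longlonglongrightarrow> 0"
      by (rule tendsto_mult_right_zero) (use powser_times_n_limit_0[of "norm q"] q in simp)
    have "norm (\<Sum>s=1..n. ?F n s) \<le> (\<Sum>s=1..n. C * norm q ^ n)" for n
    proof (rule sum_norm_le)
      fix s assume s: "s \<in> {1..n}"
      then have "n \<le> s * n" by simp
      then have "n \<le> triangle s + s * n" by (rule trans_le_add2)
      then have "norm q ^ (triangle s + s * n) \<le> norm q ^ n"
        using q by (intro power_decreasing) auto
      then show "norm (?F n s) \<le> C * norm q ^ n"
        using norm_one_minus_prod_le[OF q, of s n]
        by (simp add: norm_mult norm_power C_def mult_mono)
    qed
    then show "\<forall>\<^sub>F n in sequentially. norm (\<Sum>s=1..n. ?F n s) \<le> C * (real n * norm q ^ n)"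
      by (intro always_eventually allI) (simp add: mult_ac)
  qed
  from tendsto_add[OF P this] have "(\<lambda>n. ?R 0 n + (\<Sum>s=1..n. ?F n s)) \<longlonglongrightarrow> (\<Prod>n. 1 - q ^ Suc n)" by simp
  moreover have "?R 0 n + (\<Sum>s=1..n. ?F n s) = (\<Sum>s\<le>n. ?F n s)" for n
    by (simp add: atMost_atLeast0 sum.atLeast_Suc_atMost)
  ultimately show ?thesis unfolding shanks_identity by simp
qed

lemma exp_i_pi_int_uminus: "exp (- (of_real pi * \<i> * of_int n)) = (exp (of_real pi * \<i> * of_int n) :: complex)"
proof -
  have "exp (of_real pi * \<i> * of_int n) = exp (- (of_real pi * \<i> * of_int n) + 2 * of_real pi * \<i> * of_int n)"
    by (rule arg_cong[where f = exp]) algebra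
  then show ?thesis by (simp only: exp_add exp_2pi_i_int mult_1_right)
qed

text \<open>The terms of the pentagonal series for the eta function, with the factor \<open>q\<close> to the power \<open>1 / 24\<close> absorbed into a perfect square.\<close>

definition eta_term :: "complex \<Rightarrow> int \<Rightarrow> complex" where
  "eta_term \<tau> n = exp (of_real pi * \<i> * of_int n + of_real pi * \<i> * \<tau> / 12 * of_int (6 * n + 1) ^ 2)"

lemma eta_term_abs_summable:
  assumes "Im \<tau> > 0" shows "(\<lambda>n. norm (eta_term \<tau> n)) summable_on UNIV"
proof -
  have "Re (- 3 * of_real pi * \<i> * \<tau>) > 0" using assms by simp
  from gaussian_exp_summable[OF this, of "of_real pi * \<i> + of_real pi * \<i> * \<tau>" "of_real pi * \<i> * \<tau> / 12"]
  show ?thesis unfolding eta_term_def by (simp add: algebra_simps power2_eq_square)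
qed

text \<open>The exponents fit because \<open>(6 n + 1)\<^sup>2 / 24 = n (3 n + 1) / 2 + 1 / 24\<close>, and the fraction \<open>1 / 24\<close> is the one in the definition
of the eta function. The index \<open>- j\<close> accounts for the second power of \<open>q\<close> attached to \<open>j\<close>.\<close>

lemma eta_pentagonal:
  assumes \<tau>: "Im \<tau> > 0"
  shows "(eta_term \<tau> has_sum dedekind_eta \<tau>) UNIV"
proof -
  define q where "q = exp (2 * of_real pi * \<i> * \<tau>)"
  define u where "u = exp (of_real pi * \<i> * \<tau> / 12)"
  have q: "norm q < 1" using \<tau> by (simp add: q_def norm_exp_eq_Re)
  have qpow: "q ^ m = exp (2 * of_real pi * \<i> * \<tau> * of_nat m)" for m
    unfolding q_def exp_of_nat_mult[symmetric] by (simp add: mult_ac)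
  have eta: "dedekind_eta \<tau> = u * (\<Prod>n. 1 - q ^ Suc n)"
    unfolding dedekind_eta_def cis_pow_def qpow u_def by (simp add: mult_ac)
  have sgn: "exp (of_real pi * \<i> * of_int (int j)) = (-1) ^ j" for j
    using exp_of_nat_mult[of j "of_real pi * \<i>"] by (simp add: mult_ac)
  have tri: "(of_nat (triangle j) :: complex) = of_nat j * (of_nat j + 1) / 2" for j
  proof -
    have "2 * (of_nat (triangle j) :: complex) = of_nat (2 * triangle j)" by simp
    then show ?thesis unfolding two_triangle by (simp add: field_simps)
  qed
  have pos: "eta_term \<tau> (int j) = u * ((-1) ^ j * q ^ (triangle j + j * j))" for j
    unfolding eta_term_def exp_add sgn qpow u_def 
    by (simp add: tri flip: exp_add) (simp add: field_simps power2_eq_square)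
  have neg: "eta_term \<tau> (- int j) = u * ((-1) ^ j * q ^ (triangle j + j * (j - 1)))" if "j \<ge> 1" for j
  proof -
    have j: "(of_nat (j - Suc 0) :: complex) = of_nat j - 1" using that by (simp add: of_nat_diff)
    have "exp (of_real pi * \<i> * of_int (- int j)) = (-1) ^ j"
      using exp_i_pi_int_uminus[of "int j"] sgn[of j] by simp
    then show ?thesis
      unfolding eta_term_def exp_add qpow u_def
      by (simp add: tri j flip: exp_add) (simp add: field_simps power2_eq_square)
  qed
  have part: "(\<Sum>n=-int M..int M. eta_term \<tau> n) = u * (1 + (\<Sum>j=1..M. (-1) ^ j * (q ^ (triangle j + j * j) + q ^ (triangle j + j * (j - 1)))))" for M
  proof (induction M)
    case 0
    show ?case using pos[of 0] by simp
  next
    case (Suc M)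
    have "{-int (Suc M)..int (Suc M)} = insert (- int (Suc M)) (insert (int (Suc M)) {-int M..int M})" by auto
    then have "(\<Sum>n=-int (Suc M)..int (Suc M). eta_term \<tau> n) = eta_term \<tau> (- int (Suc M)) + (eta_term \<tau> (int (Suc M)) + (\<Sum>n=-int M..int M. eta_term \<tau> n))"
      by simp
    then show ?case unfolding Suc pos using neg[of "Suc M"] by (simp add: algebra_simps)
  qed
  obtain S where S: "(eta_term \<tau> has_sum S) UNIV"
    using abs_summable_summable[OF eta_term_abs_summable[OF \<tau>]] by (auto simp: summable_on_def)
  have "(\<lambda>M. \<Sum>n=-int M..int M. eta_term \<tau> n) \<longlonglongrightarrow> dedekind_eta \<tau>"
    unfolding part eta by (intro tendsto_mult_left pentagonal_number_theorem q)
  then have "S = dedekind_eta \<tau>"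
    using symmetric_partial_sums_tendsto[OF S] LIMSEQ_unique by blast
  with S show ?thesis by simp
qed

text \<open>Used modulo 3 for the eta function and modulo \<open>2 pp pm\<close> for the correction term.\<close>

lemma infsum_int_residues:
  fixes f :: "int \<Rightarrow> complex" and m :: nat
  assumes "f summable_on UNIV" "m > 0"
  shows "(\<Sum>\<^sub>\<infinity>n\<in>UNIV. f n) = (\<Sum>r<m. \<Sum>\<^sub>\<infinity>k\<in>(UNIV::int set). f (int m * k + int r))"
proof -
  let ?g = "\<lambda>(r, k). int m * k + int r"
  have bij: "bij_betw ?g ({..<m} \<times> UNIV) UNIV"
    by (rule bij_betwI[where g = "\<lambda>n. (nat (n mod int m), n div int m)"])
       (use assms(2) in \<open>auto simp: nat_less_iff\<close>)
  have "((\<lambda>x. f (?g x)) has_sum (\<Sum>\<^sub>\<infinity>n\<in>UNIV. f n)) (Sigma {..<m} (\<lambda>_. UNIV))"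
    using assms(1) by (subst has_sum_reindex_bij_betw[OF bij]) simp
  moreover have "((\<lambda>k. f (?g (r, k))) has_sum (\<Sum>\<^sub>\<infinity>k\<in>(UNIV::int set). f (int m * k + int r))) UNIV" for r
  proof -
    have "f summable_on range (\<lambda>k. int m * k + int r)" using assms(1) by (rule summable_on_subset_banach) simp
    then have "(\<lambda>k. f (int m * k + int r)) summable_on UNIV"
      using assms(2) by (subst (asm) summable_on_reindex) (auto simp: inj_def o_def)
    then show ?thesis by simp
  qed
  ultimately have "((\<lambda>r. \<Sum>\<^sub>\<infinity>k\<in>(UNIV::int set). f (int m * k + int r)) has_sum (\<Sum>\<^sub>\<infinity>n\<in>UNIV. f n)) {..<m}"
    by (rule has_sum_SigmaD)
  then show ?thesis by (simp add: has_sum_finite_iff)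
qed

lemma csqrt_divide_of_real:
  assumes "r > 0" shows "csqrt (z / of_real r) = csqrt z / of_real (sqrt r)"
proof (rule csqrt_unique)
  show "(csqrt z / of_real (sqrt r))\<^sup>2 = z / of_real r"
    using assms by (simp add: power_divide flip: of_real_power)
  show "0 < Re (csqrt z / of_real (sqrt r)) \<or> Re (csqrt z / of_real (sqrt r)) = 0 \<and> 0 \<le> Im (csqrt z / of_real (sqrt r))"
    using csqrt_principal[of z] assms by auto
qed

text \<open>Jacobi inversion turns the series of \<open>eta_term (- 1 / \<tau>)\<close> into a sum over all odd numbers \<open>2 k + 1\<close>, weighted by
\<open>exp (- \<pi> \<i> (2 k + 1) / 6)\<close>. Modulo 3 the classes \<open>k = 0\<close> and \<open>k = 2\<close> both reproduce the eta series, as the odd numbers there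
are \<open>6 n + 1\<close> up to sign, while the odd multiples of 3 cancel in pairs under \<open>k \<mapsto> - 1 - k\<close>. The two weights add up to the square root of 3,
which absorbs the factor 3 in the modulus \<open>A\<close>.\<close>

theorem dedekind_eta_inversion:
  assumes \<tau>: "Im \<tau> > 0"
  shows "dedekind_eta (- 1 / \<tau>) = csqrt (- \<i> * \<tau>) * dedekind_eta \<tau>"
proof -
  \<comment> \<open>\<open>A\<close>, \<open>w\<close> and \<open>K\<close> are read off from the coefficients of \<open>n\<^sup>2\<close>, \<open>n\<close> and 1 in the exponent of \<open>eta_term (- 1 / \<tau>) n\<close>\<close>
  define A where "A = - \<i> * \<tau> / 3"
  define w where "w = 1/2 - 1 / (2 * \<tau>)"
  define K where "K = exp (- (of_real pi * \<i> / (12 * \<tau>)))"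
  define g where "g k = exp (of_real pi * \<i> * \<tau> / 12 * of_int (2 * k + 1) ^ 2 - of_real pi * \<i> / 6 * of_int (2 * k + 1))" for k :: int
  have \<tau>0: "\<tau> \<noteq> 0" using \<tau> by auto
  have \<tau>': "Im (- 1 / \<tau>) > 0"
    using \<tau> by (simp add: Im_divide power2_eq_square add_nonneg_pos)
  have A: "Re A > 0" using \<tau> by (simp add: A_def)
  have "eta_term (- 1 / \<tau>) = (\<lambda>n. K * exp (- of_real pi * of_int n ^ 2 / A + 2 * of_real pi * \<i> * of_int n * w))"
    unfolding eta_term_def[abs_def] K_def exp_add[symmetric] w_def A_def using \<tau>0
    by (intro ext arg_cong[where f = exp]) (simp add: field_simps power2_eq_square)
  with has_sum_cmult_right[OF gauss_theta_inversion[OF A, of w], of K]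
  have "(eta_term (- 1 / \<tau>) has_sum (K * (csqrt A * gauss_theta A w))) UNIV"
    by (simp only:)
  with eta_pentagonal[OF \<tau>'] have 1: "dedekind_eta (- 1 / \<tau>) = K * (csqrt A * gauss_theta A w)"
    by (rule has_sum_unique)
  have gK: "K * exp (- (of_real pi * A) * (of_int k + w)\<^sup>2) = g k" for k
    unfolding K_def g_def exp_add[symmetric] w_def A_def using \<tau>0
    by (intro arg_cong[where f = exp]) (simp add: field_simps power2_eq_square)
  have "(\<lambda>k. norm (K * exp (- (of_real pi * A) * (of_int k + w)\<^sup>2))) summable_on UNIV"
    unfolding norm_mult by (intro summable_on_cmult_right gauss_theta_summable[OF A])
  then have gs: "g summable_on UNIV"
    unfolding gK by (rule abs_summable_summable)
  have 2: "K * gauss_theta A w = (\<Sum>\<^sub>\<infinity>k\<in>UNIV. g k)"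
    unfolding gauss_theta_def by (simp flip: gK infsum_cmult_right')
  define E where "E = dedekind_eta \<tau>"
  have E: "infsum (eta_term \<tau>) UNIV = E" unfolding E_def by (rule infsumI[OF eta_pentagonal[OF \<tau>]])
  have bij: "bij_betw (\<lambda>n::int. -1 - n) UNIV UNIV"
    by (rule bij_betwI[where g = "\<lambda>n. -1 - n"]) auto
  have r0: "(\<Sum>\<^sub>\<infinity>n\<in>UNIV. g (3 * n)) = exp (- (of_real pi * \<i> / 6)) * E"
  proof -
    have "g (3 * n) = exp (- (of_real pi * \<i> / 6)) * eta_term \<tau> n" for n
    proof -
      have "g (3 * n) = exp (- (of_real pi * \<i> / 6)) * (exp (- (of_real pi * \<i> * of_int n)) * exp (of_real pi * \<i> * \<tau> / 12 * of_int (6 * n + 1) ^ 2))"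
        unfolding g_def exp_add[symmetric] by (intro arg_cong[where f = exp]) (simp add: field_simps power2_eq_square)
      then show ?thesis unfolding exp_i_pi_int_uminus eta_term_def exp_add .
    qed
    then show ?thesis by (simp add: infsum_cmult_right' E)
  qed
  have r1: "(\<Sum>\<^sub>\<infinity>n\<in>UNIV. g (3 * n + 1)) = 0"
  proof -
    have odd: "g (3 * (-1 - n) + 1) = - g (3 * n + 1)" for n
    proof -
      have "g (3 * (-1 - n) + 1) = g (3 * n + 1) * exp (of_real pi * \<i>) * exp (2 * of_real pi * \<i> * of_int n)"
        unfolding g_def exp_add[symmetric] by (intro arg_cong[where f = exp]) (simp add: field_simps power2_eq_square)
      then show ?thesis by (simp only: exp_2pi_i_int exp_pi_i') simp
    qed
    have "(\<Sum>\<^sub>\<infinity>n\<in>UNIV. g (3 * n + 1)) = (\<Sum>\<^sub>\<infinity>n\<in>UNIV. g (3 * (-1 - n) + 1))"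
      by (rule infsum_reindex_bij_betw[OF bij, symmetric])
    also have "\<dots> = - (\<Sum>\<^sub>\<infinity>n\<in>UNIV. g (3 * n + 1))" unfolding odd by (rule infsum_uminus)
    finally show ?thesis by simp
  qed
  have r2: "(\<Sum>\<^sub>\<infinity>n\<in>UNIV. g (3 * n + 2)) = exp (of_real pi * \<i> / 6) * E"
  proof -
    have "g (3 * n + 2) = exp (of_real pi * \<i> / 6) * eta_term \<tau> (-1 - n)" for n
      unfolding g_def eta_term_def exp_add[symmetric] by (intro arg_cong[where f = exp]) (simp add: field_simps power2_eq_square)
    then have "(\<Sum>\<^sub>\<infinity>n\<in>UNIV. g (3 * n + 2)) = exp (of_real pi * \<i> / 6) * (\<Sum>\<^sub>\<infinity>n\<in>UNIV. eta_term \<tau> (-1 - n))"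
      by (simp add: infsum_cmult_right')
    then show ?thesis by (simp only: infsum_reindex_bij_betw[OF bij] E)
  qed
  have "(\<Sum>\<^sub>\<infinity>k\<in>UNIV. g k) = (exp (- (of_real pi * \<i> / 6)) + exp (of_real pi * \<i> / 6)) * E"
    using infsum_int_residues[OF gs, of 3] r0 r1 r2 by (simp add: numeral_3_eq_3 algebra_simps)
  also have "exp (- (of_real pi * \<i> / 6)) + exp (of_real pi * \<i> / 6) = 2 * cos (of_real (pi / 6))"
    by (simp add: cos_exp_eq mult_ac)
  also have "\<dots> = of_real (sqrt 3)" by (simp only: cos_of_real cos_30) simp
  finally have 3: "K * gauss_theta A w = of_real (sqrt 3) * E" unfolding 2 .
  have 4: "csqrt A = csqrt (- \<i> * \<tau>) / of_real (sqrt 3)"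
    unfolding A_def using csqrt_divide_of_real[of 3 "- \<i> * \<tau>"] by simp
  have "dedekind_eta (- 1 / \<tau>) = csqrt A * (K * gauss_theta A w)" unfolding 1 by (simp only: mult_ac)
  also have "\<dots> = csqrt (- \<i> * \<tau>) * E" unfolding 3 4 by simp
  finally show ?thesis unfolding E_def .
qed

section \<open>Half sums of theta terms as integrals\<close>

text \<open>As the ratio has constant modulus below 1, the \<open>L\<^sup>1\<close> norms of the terms form a geometric series and term by term integration is justified.\<close>

lemma geometric_series_integral:
  fixes f r :: "real \<Rightarrow> complex"
  assumes f: "integrable lborel f" and r: "r \<in> borel_measurable borel"
    and norm_r: "\<And>x. norm (r x) = \<rho>" and \<rho>: "\<rho> < 1"
  shows "integrable lborel (\<lambda>x. f x / (1 - r x))"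
    and "(\<lambda>k. LINT x|lborel. f x * r x ^ k) sums (LINT x|lborel. f x / (1 - r x))"
proof -
  have \<rho>0: "\<rho> \<ge> 0" using norm_r[of 0] norm_ge_zero[of "r 0"] by simp
  have nf: "norm (f x * r x ^ k) = \<rho> ^ k * norm (f x)" for x k
    by (simp add: norm_mult norm_power norm_r)
  have int: "integrable lborel (\<lambda>x. f x * r x ^ k)" for k
  proof (rule Bochner_Integration.integrable_bound)
    show "integrable lborel (\<lambda>x. \<rho> ^ k * norm (f x))" using f by simp
    show "(\<lambda>x. f x * r x ^ k) \<in> borel_measurable lborel" using f r by simp
    show "AE x in lborel. norm (f x * r x ^ k) \<le> norm (\<rho> ^ k * norm (f x))"
      unfolding nf using \<rho>0 by simp
  qed
  have geo: "summable (\<lambda>k. \<rho> ^ k * c)" for c using \<rho> \<rho>0 by (intro summable_mult2 summable_geometric) simp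
  have sm: "(\<Sum>k. f x * r x ^ k) = f x / (1 - r x)" for x
  proof -
    have "(\<lambda>k. r x ^ k) sums (1 / (1 - r x))" using \<rho> by (intro geometric_sums) (simp add: norm_r)
    from sums_mult[OF this, of "f x"] show ?thesis by (simp add: sums_iff)
  qed
  have AE: "AE x in lborel. summable (\<lambda>k. norm (f x * r x ^ k))" unfolding nf using geo by simp
  have S: "summable (\<lambda>k. LINT x|lborel. norm (f x * r x ^ k))" unfolding nf using geo by simp
  show "integrable lborel (\<lambda>x. f x / (1 - r x))"
    using integrable_suminf[OF int AE S] unfolding sm .
  show "(\<lambda>k. LINT x|lborel. f x * r x ^ k) sums (LINT x|lborel. f x / (1 - r x))"
    using sums_integral[OF int AE S] unfolding sm .
qed

text \<open>The integrand of the Gaussian integrals before any power of the geometric ratio is attached: the plane wave of frequency \<open>d / s\<close> at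
\<open>x + \<i> \<epsilon>\<close> times \<open>q\<close> to the power \<open>x\<^sup>2 / 2\<close>.\<close>

definition wave :: "real \<Rightarrow> complex \<Rightarrow> complex \<Rightarrow> int \<Rightarrow> real \<Rightarrow> complex" where
  "wave s \<epsilon> \<tau> d x = exp (2 * of_real pi * \<i> * (of_real x + \<i> * \<epsilon>) * of_real (of_int d / s) + of_real pi * \<i> * \<tau> * of_real x ^ 2)"

definition ratio :: "real \<Rightarrow> complex \<Rightarrow> real \<Rightarrow> complex" where
  "ratio s \<epsilon> x = exp (2 * of_real pi * \<i> * of_real s * (of_real x + \<i> * \<epsilon>))"

definition node :: "real \<Rightarrow> int \<Rightarrow> int \<Rightarrow> real" where
  "node s d k = s * of_int k + of_int d / s"

text \<open>Indexed by all integers: the partial theta functions at \<open>- 1 / \<tau>\<close> sum over \<open>k \<ge> 0\<close>, and \<open>k < 0\<close> is needed when \<open>Re \<epsilon> < 0\<close>.\<close>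

definition theta_term :: "real \<Rightarrow> complex \<Rightarrow> complex \<Rightarrow> int \<Rightarrow> int \<Rightarrow> complex" where
  "theta_term s \<epsilon> \<tau> d k = exp (- 2 * of_real pi * \<epsilon> * of_real (node s d k) - of_real pi * \<i> / \<tau> * of_real (node s d k) ^ 2)"

text \<open>The summands obtained from \<open>theta_term\<close> by Poisson summation, without the constant in front.\<close>

definition dual_theta_term :: "real \<Rightarrow> complex \<Rightarrow> complex \<Rightarrow> int \<Rightarrow> int \<Rightarrow> complex" where
  "dual_theta_term s \<epsilon> \<tau> d n = exp (- (2 * of_real pi * \<i> * of_int n * of_real (of_int d / s\<^sup>2))) * exp (of_real pi * \<i> * \<tau> * (of_real (of_int n / s) + \<i> * \<epsilon>) ^ 2)"

text \<open>Completing the square: \<open>node s d k\<close> is the frequency of the oscillation in \<open>x\<close>, and the shift of \<open>x\<close> by \<open>\<i> \<epsilon>\<close>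
only contributes the factor \<open>exp (- 2 \<pi> \<epsilon> y)\<close>.\<close>

lemma wave_ratio_integral:
  assumes "Im \<tau> > 0"
  shows "integrable lborel (\<lambda>x. wave s \<epsilon> \<tau> d x * ratio s \<epsilon> x powi k)"
    and "(LINT x|lborel. wave s \<epsilon> \<tau> d x * ratio s \<epsilon> x powi k) = theta_term s \<epsilon> \<tau> d k / csqrt (- \<i> * \<tau>)"
proof -
  define y where "y = node s d k"
  define a where "a = - \<i> * \<tau>"
  have \<tau>0: "\<tau> \<noteq> 0" using assms by auto
  have a: "Re a > 0" "Re (of_real pi * a) > 0" using assms by (auto simp: a_def)
  have eq: "wave s \<epsilon> \<tau> d x * ratio s \<epsilon> x powi k = exp (- (of_real pi * a) * of_real x ^ 2 + (2 * of_real pi * \<i> * of_real y) * of_real x + (- 2 * of_real pi * \<epsilon> * of_real y))" for x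
  proof -
    have "ratio s \<epsilon> x powi k = exp (of_int k * (2 * of_real pi * \<i> * of_real s * (of_real x + \<i> * \<epsilon>)))"
      by (simp add: ratio_def exp_power_int)
    then show ?thesis
      unfolding wave_def by (simp only: exp_add[symmetric]) (rule arg_cong[where f = exp], simp add: a_def y_def node_def algebra_simps)
  qed
  show "integrable lborel (\<lambda>x. wave s \<epsilon> \<tau> d x * ratio s \<epsilon> x powi k)"
    unfolding eq by (rule integrable_gaussian_exp[OF a(2)])
  have "(LINT x|lborel. wave s \<epsilon> \<tau> d x * ratio s \<epsilon> x powi k) = (LINT x|lborel. exp (- (of_real pi * a) * of_real x ^ 2 + (2 * of_real pi * \<i> * of_real y) * of_real x)) * exp (- 2 * of_real pi * \<epsilon> * of_real y)"
    unfolding eq exp_add[of _ "- 2 * of_real pi * \<epsilon> * of_real y"] by simp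
  also have "\<dots> = exp ((2 * of_real pi * \<i> * of_real y)\<^sup>2 / (4 * of_real pi * a) + - 2 * of_real pi * \<epsilon> * of_real y) / csqrt a"
    unfolding gaussian_integral_complex[OF a(1)] by (simp only: exp_add times_divide_eq_left)
  also have "(2 * of_real pi * \<i> * of_real y)\<^sup>2 / (4 * of_real pi * a) + - 2 * of_real pi * \<epsilon> * of_real y = - 2 * of_real pi * \<epsilon> * of_real y - of_real pi * \<i> / \<tau> * of_real y ^ 2"
    using \<tau>0 by (simp add: a_def power2_eq_square field_simps)
  finally show "(LINT x|lborel. wave s \<epsilon> \<tau> d x * ratio s \<epsilon> x powi k) = theta_term s \<epsilon> \<tau> d k / csqrt (- \<i> * \<tau>)"
    by (simp add: theta_term_def y_def a_def)
qed

lemma norm_ratio: "norm (ratio s \<epsilon> x) = exp (- 2 * pi * s * Re \<epsilon>)"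
  by (simp add: ratio_def norm_exp_eq_Re)

lemma ratio_nonzero [simp]: "ratio s \<epsilon> x \<noteq> 0" by (simp add: ratio_def)

lemma ratio_measurable [measurable]: "ratio s \<epsilon> \<in> borel_measurable borel"
  unfolding ratio_def by (intro borel_measurable_continuous_onI continuous_intros)

lemma ratio_neq_1:
  assumes "s > 0" "Re \<epsilon> \<noteq> 0" shows "ratio s \<epsilon> x \<noteq> 1"
proof
  assume "ratio s \<epsilon> x = 1"
  with norm_ratio[of s \<epsilon> x] have "exp (- 2 * pi * s * Re \<epsilon>) = 1" by simp
  then show False using assms by simp
qed

lemma theta_half_sum_pos:
  assumes \<tau>: "Im \<tau> > 0" and s: "s > 0" and "Re \<epsilon> > 0"
  shows "integrable lborel (\<lambda>x. wave s \<epsilon> \<tau> d x / (1 - ratio s \<epsilon> x))"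
    and "(\<lambda>k. theta_term s \<epsilon> \<tau> d (int k)) sums (csqrt (- \<i> * \<tau>) * (LINT x|lborel. wave s \<epsilon> \<tau> d x / (1 - ratio s \<epsilon> x)))"
proof -
  have f: "integrable lborel (wave s \<epsilon> \<tau> d)"
    using wave_ratio_integral(1)[OF \<tau>, of s \<epsilon> d 0] by simp
  have \<rho>: "exp (- 2 * pi * s * Re \<epsilon>) < 1" using assms by simp
  note g = geometric_series_integral[OF f ratio_measurable norm_ratio \<rho>]
  show "integrable lborel (\<lambda>x. wave s \<epsilon> \<tau> d x / (1 - ratio s \<epsilon> x))" by (rule g)
  have "csqrt (- \<i> * \<tau>) \<noteq> 0" using \<tau> by auto
  then show "(\<lambda>k. theta_term s \<epsilon> \<tau> d (int k)) sums (csqrt (- \<i> * \<tau>) * (LINT x|lborel. wave s \<epsilon> \<tau> d x / (1 - ratio s \<epsilon> x)))"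
    using sums_mult[OF g(2), of "csqrt (- \<i> * \<tau>)"] wave_ratio_integral(2)[OF \<tau>, of s \<epsilon> d "int _"] by simp
qed

text \<open>Here the ratio exceeds 1 in modulus, so the expansion is in its inverse: \<open>1 / (1 - V) = - (1 / V + 1 / V\<^sup>2 + \<dots>)\<close>.\<close>

lemma theta_half_sum_neg:
  assumes \<tau>: "Im \<tau> > 0" and s: "s > 0" and "Re \<epsilon> < 0"
  shows "integrable lborel (\<lambda>x. wave s \<epsilon> \<tau> d x / (1 - ratio s \<epsilon> x))"
    and "(\<lambda>k. theta_term s \<epsilon> \<tau> d (- 1 - int k)) sums (- csqrt (- \<i> * \<tau>) * (LINT x|lborel. wave s \<epsilon> \<tau> d x / (1 - ratio s \<epsilon> x)))"
proof -
  define f where "f x = wave s \<epsilon> \<tau> d x * ratio s \<epsilon> x powi (- 1)" for x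
  have f: "integrable lborel f"
    unfolding f_def by (rule wave_ratio_integral(1)[OF \<tau>])
  have r: "(\<lambda>x. inverse (ratio s \<epsilon> x)) \<in> borel_measurable borel" by measurable
  have nr: "norm (inverse (ratio s \<epsilon> x)) = exp (2 * pi * s * Re \<epsilon>)" for x
    by (simp add: norm_inverse norm_ratio exp_minus)
  have \<rho>: "exp (2 * pi * s * Re \<epsilon>) < 1" using assms by (simp add: mult_pos_neg)
  note g = geometric_series_integral[OF f r nr \<rho>]
  have fe: "f x / (1 - inverse (ratio s \<epsilon> x)) = - (wave s \<epsilon> \<tau> d x / (1 - ratio s \<epsilon> x))" for x
    using ratio_neq_1[OF s, of \<epsilon> x] assms ratio_nonzero[of s \<epsilon> x] unfolding f_def
    by (simp add: power_int_minus divide_simps) (simp add: algebra_simps)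
  have fk: "f x * inverse (ratio s \<epsilon> x) ^ k = wave s \<epsilon> \<tau> d x * ratio s \<epsilon> x powi (- 1 - int k)" for x k
    unfolding f_def by (simp add: power_int_diff power_int_minus power_inverse divide_inverse)
  from g(1) show "integrable lborel (\<lambda>x. wave s \<epsilon> \<tau> d x / (1 - ratio s \<epsilon> x))"
    unfolding fe by simp
  have "csqrt (- \<i> * \<tau>) \<noteq> 0" using \<tau> by auto
  then show "(\<lambda>k. theta_term s \<epsilon> \<tau> d (- 1 - int k)) sums (- csqrt (- \<i> * \<tau>) * (LINT x|lborel. wave s \<epsilon> \<tau> d x / (1 - ratio s \<epsilon> x)))"
    using sums_mult[OF g(2)[unfolded fk fe], of "csqrt (- \<i> * \<tau>)"] wave_ratio_integral(2)[OF \<tau>, of s \<epsilon> d] by simp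
qed

text \<open>With \<open>N = s\<^sup>2 / 2\<close> the node is \<open>s (k + d / (2 N))\<close>, which is the index of the partial theta function scaled by \<open>s\<close>.\<close>

lemma partial_theta_eq:
  assumes s: "s\<^sup>2 = 2 * real N" "s > 0"
  shows "partial_theta (- of_real s * \<epsilon>) N d 0 (- 1 / \<tau>) = (\<Sum>k. theta_term s \<epsilon> \<tau> d (int k))"
  unfolding partial_theta_def
proof (rule arg_cong[where f = suminf], rule ext)
  fix k
  define v where "v = real k + of_int d / (2 * real N)"
  have N: "real N = s\<^sup>2 / 2" using s by simp
  have y: "node s d (int k) = s * v" using s(2) unfolding node_def v_def N by (simp add: field_simps power2_eq_square)
  have v: "of_nat k + of_int d / (2 * of_nat N) = (of_real v :: complex)" by (simp add: v_def)
  have NN: "(of_nat N :: complex) = of_real s ^ 2 / 2" using arg_cong[OF N, of complex_of_real] by simp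
  show "exp (2 * of_real pi * (- of_real s * \<epsilon>) * (of_nat k + of_int d / (2 * of_nat N))) * cis_pow 0 (of_nat k + of_int d / (2 * of_nat N)) *
     cis_pow (- 1 / \<tau>) (of_nat N * (of_nat k + of_int d / (2 * of_nat N))\<^sup>2) = theta_term s \<epsilon> \<tau> d (int k)"
    unfolding v unfolding theta_term_def y NN cis_pow_def
    by (simp add: power_mult_distrib mult_ac flip: exp_add)
qed

section \<open>The sum over all integers\<close>

text \<open>The linear term in the exponent is absorbed by the complex shift \<open>w\<close> of the theta function, after which Jacobi inversion applies with
modulus \<open>A = s\<^sup>2 / a\<close>, \<open>a = - \<i> \<tau>\<close>. The reflection \<open>n \<mapsto> - n\<close> brings the dual exponent to the form with \<open>n / s + \<i> \<epsilon>\<close>.\<close>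

lemma theta_full_sum:
  assumes \<tau>: "Im \<tau> > 0" and s: "s > 0"
  shows "(theta_term s \<epsilon> \<tau> d has_sum (csqrt (- \<i> * \<tau>) / of_real s *
      infsum (dual_theta_term s \<epsilon> \<tau> d) UNIV)) UNIV"
proof -
  define a where "a = - \<i> * \<tau>"
  define A where "A = of_real (s\<^sup>2) / a"
  define w where "w = of_real (of_int d / s\<^sup>2) + \<epsilon> * a / of_real s"
  define K where "K = exp (of_real pi * \<epsilon>\<^sup>2 * a)"
  define W where "W = dual_theta_term s \<epsilon> \<tau> d"
  have \<tau>0: "\<tau> \<noteq> 0" using \<tau> by auto
  have a: "Re a > 0" "a \<noteq> 0" using \<tau> by (auto simp: a_def)
  have csa: "csqrt a \<noteq> 0" using a by simp
  have A: "Re A > 0"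
    using a s by (simp add: A_def Re_divide power2_eq_square add_pos_nonneg)
  have csA: "csqrt A = of_real s / csqrt a"
  proof (rule csqrt_unique)
    show "(of_real s / csqrt a)\<^sup>2 = A" by (simp add: A_def power_divide)
    have "Re (csqrt a) > 0"
    proof (rule ccontr)
      assume "\<not> Re (csqrt a) > 0"
      then have "Re (csqrt a) = 0" using csqrt_principal[of a] by auto
      then have "Re ((csqrt a)\<^sup>2) \<le> 0" unfolding Re_power2 by simp
      with a(1) show False by simp
    qed
    then have "Re (of_real s / csqrt a) > 0"
      using s by (simp add: Re_divide add_pos_nonneg)
    then show "0 < Re (of_real s / csqrt a) \<or> Re (of_real s / csqrt a) = 0 \<and> 0 \<le> Im (of_real s / csqrt a)" by blast
  qed
  have gauss_term: "theta_term s \<epsilon> \<tau> d k = K * exp (- (of_real pi * A) * (of_int k + w)\<^sup>2)" for k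
    unfolding theta_term_def K_def node_def exp_add[symmetric] A_def w_def a_def using \<tau>0 s
    by (intro arg_cong[where f = exp]) (simp add: field_simps power2_eq_square)
  have W: "K * exp (- of_real pi * of_int (- n) ^ 2 / A + 2 * of_real pi * \<i> * of_int (- n) * w) = W n" for n
    unfolding W_def dual_theta_term_def K_def exp_add[symmetric] A_def w_def a_def using \<tau>0 s
    by (intro arg_cong[where f = exp]) (simp add: field_simps power2_eq_square)
  have "((\<lambda>n. K * exp (- of_real pi * of_int (- n) ^ 2 / A + 2 * of_real pi * \<i> * of_int (- n) * w)) has_sum (K * (csqrt A * gauss_theta A w))) UNIV"
    using has_sum_cmult_right[OF gauss_theta_inversion[OF A, of w], of K]
    by (subst has_sum_reindex_bij_betw[OF bij_uminus, of "\<lambda>n. K * exp (- of_real pi * of_int n ^ 2 / A + 2 * of_real pi * \<i> * of_int n * w)"])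
  then have "(W has_sum (K * (csqrt A * gauss_theta A w))) UNIV" unfolding W .
  then have "csqrt a / of_real s * infsum W UNIV = csqrt a / of_real s * (K * (csqrt A * gauss_theta A w))"
    by (simp only: infsumI)
  also have "\<dots> = K * gauss_theta A w"
    unfolding csA using csa s by simp
  finally have eq: "csqrt a / of_real s * infsum W UNIV = K * gauss_theta A w" .
  have "((\<lambda>k. exp (- (of_real pi * A) * (of_int k + w)\<^sup>2)) has_sum gauss_theta A w) UNIV"
    unfolding gauss_theta_def using abs_summable_summable[OF gauss_theta_summable[OF A]] by (rule has_sum_infsum)
  from has_sum_cmult_right[OF this, of K] show ?thesis
    unfolding gauss_term[abs_def] W_def[symmetric] a_def[symmetric] eq .
qed

section \<open>The S-kernel and the correction term\<close>

text \<open>Since \<open>pp pm / s = s / 2\<close>, the shift of \<open>b\<close> by \<open>pp pm\<close> contributes \<open>exp (- \<pi> \<i> s w)\<close>, which turns the sine in the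
denominator into \<open>1 - V\<close> with \<open>V = ratio s \<epsilon> x\<close>; the other sine splits \<open>b\<close> into \<open>b - c\<close> and \<open>b + c\<close>. The real exponential of the kernel
cancels that of the Fock character.\<close>

lemma S_kernel_fock_char:
  fixes pp pm :: nat
  defines "s \<equiv> sqrt (2 * real pp * real pm)"
  assumes s: "s > 0" and \<epsilon>: "Re \<epsilon> \<noteq> 0"
  shows "S_kernel pp pm \<epsilon> b c x * fock_char pp pm \<epsilon> (x + alpha_zero pp pm / 2) \<tau>
       = - (wave s \<epsilon> \<tau> (b - c) x / (1 - ratio s \<epsilon> x) - wave s \<epsilon> \<tau> (b + c) x / (1 - ratio s \<epsilon> x)) / dedekind_eta \<tau>"
proof -
  define w where "w = of_real x + \<i> * \<epsilon>"
  define S where "S = complex_of_real s"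
  define U where "U = exp (2 * of_real pi * \<i> * of_int c * w / S)"
  define B where "B = exp (2 * of_real pi * \<i> * of_int b * w / S)"
  define V where "V = exp (of_real pi * \<i> * S * w)"
  define Q where "Q = exp (of_real pi * \<i> * \<tau> * of_real x ^ 2)"
  have nz: "U \<noteq> 0" "V \<noteq> 0" by (simp_all add: U_def V_def)
  have s2: "s\<^sup>2 = 2 * real (pp * pm)" unfolding s_def by simp
  have S2: "(of_nat (pp * pm) :: complex) = S\<^sup>2 / 2"
    using arg_cong[OF s2, of complex_of_real] by (simp add: S_def)
  have S0: "S \<noteq> 0" using s by (simp add: S_def)
  have V2: "ratio s \<epsilon> x = V\<^sup>2"
    unfolding ratio_def V_def w_def S_def exp_of_nat_mult[symmetric, of 2, simplified] by (simp add: mult_ac power2_eq_square flip: exp_add)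
  have V1: "V\<^sup>2 \<noteq> 1" using ratio_neq_1[OF s \<epsilon>, of x] unfolding V2 .
  have wm: "wave s \<epsilon> \<tau> (b - c) x = B / U * Q"
    unfolding wave_def B_def U_def Q_def exp_diff[symmetric] exp_add[symmetric] w_def[symmetric]
    by (intro arg_cong[where f = exp]) (use S0 in \<open>simp add: S_def field_simps\<close>)
  have wp: "wave s \<epsilon> \<tau> (b + c) x = B * U * Q"
    unfolding wave_def B_def U_def Q_def exp_add[symmetric] w_def[symmetric]
    by (intro arg_cong[where f = exp]) (use S0 in \<open>simp add: S_def field_simps\<close>)
  have e1: "exp (2 * of_real pi * \<i> * ((of_int b - of_nat (pp * pm)) / S) * w) = B / V"
    unfolding S2 B_def V_def exp_diff[symmetric]
    by (intro arg_cong[where f = exp]) (use S0 in \<open>simp add: field_simps power2_eq_square\<close>)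
  have s1: "sin (2 * of_real pi * of_int c * (w / S)) = (U - 1 / U) / (2 * \<i>)"
    unfolding sin_exp_eq U_def by (simp add: exp_minus inverse_eq_divide mult_ac)
  have s2: "sin (of_real pi * S * w) = (V - 1 / V) / (2 * \<i>)"
    unfolding sin_exp_eq V_def by (simp add: exp_minus inverse_eq_divide mult_ac)
  have "S_kernel pp pm \<epsilon> b c x = - exp (- 2 * of_real pi * \<epsilon> * of_real x) * (B / V) * (((U - 1 / U) / (2 * \<i>)) / ((V - 1 / V) / (2 * \<i>)))"
    unfolding S_kernel_def s_def[symmetric] S_def[symmetric] w_def[symmetric] e1 s1 s2 ..
  moreover have "fock_char pp pm \<epsilon> (x + alpha_zero pp pm / 2) \<tau> = exp (2 * of_real pi * \<epsilon> * of_real x) * Q / dedekind_eta \<tau>"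
    by (simp add: fock_char_def Q_def cis_pow_def mult_ac)
  moreover have "exp (- 2 * of_real pi * \<epsilon> * of_real x) * exp (2 * of_real pi * \<epsilon> * of_real x) = 1"
    by (simp flip: exp_add)
  ultimately have "S_kernel pp pm \<epsilon> b c x * fock_char pp pm \<epsilon> (x + alpha_zero pp pm / 2) \<tau>
     = - (B / V * (((U - 1 / U) / (2 * \<i>)) / ((V - 1 / V) / (2 * \<i>))) * Q) / dedekind_eta \<tau>"
    by (simp add: mult_ac)
  also have "B / V * (((U - 1 / U) / (2 * \<i>)) / ((V - 1 / V) / (2 * \<i>))) * Q = (B / U * Q) / (1 - V\<^sup>2) - (B * U * Q) / (1 - V\<^sup>2)"
  proof -
    have V_minus: "V - 1 / V = (V\<^sup>2 - 1) / V" using nz by (simp add: field_simps power2_eq_square)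
    have "B / V * (((U - 1 / U) / (2 * \<i>)) / ((V - 1 / V) / (2 * \<i>))) = B / V * ((U - 1 / U) / ((V\<^sup>2 - 1) / V))"
      unfolding V_minus by simp
    also have "\<dots> = B * (U - 1 / U) / (V\<^sup>2 - 1)" using nz by simp
    also have "\<dots> = - (B * (U - 1 / U)) / - (V\<^sup>2 - 1)" by (simp only: minus_divide_divide)
    also have "\<dots> = B * (1 / U - U) / (1 - V\<^sup>2)" by (simp add: algebra_simps)
    finally have "B / V * (((U - 1 / U) / (2 * \<i>)) / ((V - 1 / V) / (2 * \<i>))) = B * (1 / U - U) / (1 - V\<^sup>2)" .
    then show ?thesis
      by (simp only: diff_divide_distrib right_diff_distrib left_diff_distrib times_divide_eq_left times_divide_eq_right mult_1_right)
  qed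
  finally show ?thesis unfolding V2 wm wp .
qed

text \<open>The prefactor \<open>q\<close> to the power \<open>- \<epsilon>\<^sup>2 / 2\<close> completes the square.\<close>

lemma theta_fn_eq:
  assumes s: "s\<^sup>2 = 2 * real N" "s > 0"
  shows "cis_pow \<tau> (- (\<epsilon>\<^sup>2) / 2) * theta_fn N (int m) (\<i> * of_real s * \<epsilon> * \<tau>) \<tau>
    = (\<Sum>\<^sub>\<infinity>k\<in>(UNIV::int set). exp (of_real pi * \<i> * \<tau> * (of_real (of_int (int (2 * N) * k + int m) / s) + \<i> * \<epsilon>) ^ 2))"
  unfolding theta_fn_def infsum_cmult_right'[symmetric]
proof (rule infsum_cong)
  fix k :: int
  define S where "S = complex_of_real s"
  define v where "v = (of_int k + of_int (int m) / (2 * of_nat N) :: complex)"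
  have N: "(of_nat N :: complex) = S\<^sup>2 / 2"
    using arg_cong[OF s(1), of complex_of_real] by (simp add: S_def)
  have S0: "S \<noteq> 0" using s by (simp add: S_def)
  have y: "complex_of_real (of_int (int (2 * N) * k + int m) / s) = S * v"
    unfolding v_def using S0 by (simp add: N flip: S_def) (simp add: field_simps power2_eq_square)
  show "cis_pow \<tau> (- (\<epsilon>\<^sup>2) / 2) * (cis_pow (\<i> * of_real s * \<epsilon> * \<tau>) (of_int k + of_int (int m) / (2 * of_nat N)) *
      cis_pow \<tau> (of_nat N * (of_int k + of_int (int m) / (2 * of_nat N))\<^sup>2))
    = exp (of_real pi * \<i> * \<tau> * (of_real (of_int (int (2 * N) * k + int m) / s) + \<i> * \<epsilon>) ^ 2)"
    unfolding y v_def[symmetric] unfolding N S_def[symmetric] cis_pow_def exp_add[symmetric]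
    by (intro arg_cong[where f = exp]) (simp add: field_simps power2_eq_square)
qed

text \<open>The phases of the dual theta terms depend on \<open>n\<close> modulo \<open>2 pp pm\<close> only, so they can be taken out of the sum over each residue class; for
\<open>b - c\<close> and \<open>b + c\<close> they differ by \<open>2 \<i>\<close> times the sine and the phase belonging to \<open>b\<close>.\<close>

lemma correction_term_eq:
  fixes pp pm :: nat
  defines "s \<equiv> sqrt (2 * real pp * real pm)"
  assumes s: "s > 0" and \<tau>: "Im \<tau> > 0"
  shows "2 * correction_term pp pm \<epsilon> b c \<tau> = (infsum (dual_theta_term s \<epsilon> \<tau> (b - c)) UNIV - infsum (dual_theta_term s \<epsilon> \<tau> (b + c)) UNIV) / (of_real s * dedekind_eta \<tau>)"
proof -
  define M where "M d = infsum (dual_theta_term s \<epsilon> \<tau> d) UNIV" for d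
  define N where "N = pp * pm"
  define W where "W n = exp (of_real pi * \<i> * \<tau> * (of_real (of_int n / s) + \<i> * \<epsilon>) ^ 2)" for n :: int
  define \<Theta> where "\<Theta> m = (\<Sum>\<^sub>\<infinity>k\<in>(UNIV::int set). W (int (2 * N) * k + int m))" for m :: nat
  define e where "e d n = exp (- (2 * of_real pi * \<i> * of_int n * of_real (of_int d / s\<^sup>2)))" for d n :: int
  have s2: "s\<^sup>2 = 2 * real N" unfolding s_def N_def by simp
  have N0: "N > 0" using s s2 by (cases "N = 0") auto
  have e_per: "e d (int (2 * N) * k + r) = e d r" for d k r
  proof -
    have "e d (int (2 * N) * k + r) = e d r * exp (2 * of_real pi * \<i> * of_int (- (k * d)))"
      unfolding e_def s2 exp_add[symmetric] using N0
      by (intro arg_cong[where f = exp]) (simp add: field_simps)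
    then show ?thesis unfolding exp_2pi_i_int by simp
  qed
  have M: "M d = (\<Sum>m<2 * N. e d (int m) * \<Theta> m)" for d
  proof -
    have "Re (- \<i> * of_real pi * \<tau> / of_real (s\<^sup>2)) > 0" using \<tau> s by (simp add: Re_divide_of_real del: of_real_power)
    from gaussian_exp_summable[OF this, of "- 2 * of_real pi * \<tau> * \<epsilon> / of_real s - 2 * of_real pi * \<i> * of_real (of_int d / s\<^sup>2)" "- of_real pi * \<i> * \<tau> * \<epsilon>\<^sup>2"]
    have "(\<lambda>n. norm (e d n * W n)) summable_on UNIV"
    proof (rule summable_on_cong[THEN iffD1, rotated])
      fix n :: int
      show "norm (exp (- (- \<i> * of_real pi * \<tau> / of_real (s\<^sup>2)) * of_int n ^ 2 + (- 2 * of_real pi * \<tau> * \<epsilon> / of_real s - 2 * of_real pi * \<i> * of_real (of_int d / s\<^sup>2)) * of_int n + - of_real pi * \<i> * \<tau> * \<epsilon>\<^sup>2))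
         = norm (e d n * W n)"
        unfolding e_def W_def exp_add[symmetric]
        by (intro arg_cong[where f = "\<lambda>z. norm (exp z)"]) (use s in \<open>simp add: field_simps power2_eq_square\<close>)
    qed
    then have sm: "(\<lambda>n. e d n * W n) summable_on UNIV" by (rule abs_summable_summable)
    have "M d = (\<Sum>\<^sub>\<infinity>n\<in>UNIV. e d n * W n)" unfolding M_def by (intro infsum_cong) (simp add: dual_theta_term_def e_def W_def)
    also have "\<dots> = (\<Sum>m<2 * N. \<Sum>\<^sub>\<infinity>k\<in>(UNIV::int set). e d (int (2 * N) * k + int m) * W (int (2 * N) * k + int m))"
      using N0 by (intro infsum_int_residues sm) simp
    also have "\<dots> = (\<Sum>m<2 * N. e d (int m) * \<Theta> m)"
      unfolding e_per \<Theta>_def by (simp only: infsum_cmult_right')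
    finally show ?thesis .
  qed
  have e_diff: "e (b - c) (int m) - e (b + c) (int m) = 2 * \<i> * (exp (- of_real pi * \<i> * (of_int b * of_nat m / of_nat N)) * sin (of_real pi * (of_int c * of_nat m / of_nat N)))" for m
  proof -
    define p where "p = of_real pi * \<i> * (of_int b * of_nat m / of_nat N) "
    define r where "r = of_real pi * (of_int c * of_nat m / of_nat N :: complex)"
    have "e (b - c) (int m) = exp (- p + \<i> * r)" "e (b + c) (int m) = exp (- p + - (\<i> * r))"
      unfolding e_def s2 p_def r_def using N0 by (auto intro!: arg_cong[where f = exp] simp: field_simps)
    moreover have "2 * \<i> * sin r = exp (\<i> * r) - exp (- (\<i> * r))"
      by (simp add: sin_exp_eq)
    moreover have "exp (- p) * (exp (\<i> * r) - exp (- (\<i> * r))) = exp (- p + \<i> * r) - exp (- p + - (\<i> * r))"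
      by (simp only: exp_add right_diff_distrib)
    ultimately have "e (b - c) (int m) - e (b + c) (int m) = exp (- p) * (2 * \<i> * sin r)" by simp
    then show ?thesis by (simp add: p_def r_def mult_ac)
  qed
  have "M (b - c) - M (b + c) = (\<Sum>m<2 * N. 2 * \<i> * (exp (- of_real pi * \<i> * (of_int b * of_nat m / of_nat N)) * sin (of_real pi * (of_int c * of_nat m / of_nat N)) * \<Theta> m))"
    unfolding M sum_subtractf[symmetric] left_diff_distrib[symmetric] e_diff by (simp only: mult.assoc)
  moreover have "2 * correction_term pp pm \<epsilon> b c \<tau> = (\<Sum>m<2 * N. 2 * \<i> * (exp (- of_real pi * \<i> * (of_int b * of_nat m / of_nat N)) * sin (of_real pi * (of_int c * of_nat m / of_nat N)) * \<Theta> m)) / (of_real s * dedekind_eta \<tau>)"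
    unfolding correction_term_def s_def[symmetric] N_def[symmetric] mult.assoc[of 2 pp pm] \<Theta>_def W_def theta_fn_eq[OF s2 s, symmetric]
    unfolding sum_distrib_left sum_divide_distrib
    by (intro sum.cong refl) (simp add: mult_ac)
  ultimately show ?thesis by (simp add: M_def)
qed

lemma has_sum_int_split:
  fixes f :: "int \<Rightarrow> complex"
  assumes "(f has_sum S) UNIV" and neg: "(\<lambda>k. f (- 1 - int k)) sums A"
  shows "(\<lambda>k. f (int k)) sums (S - A)"
proof -
  have sm: "f summable_on X" for X
    using assms(1) summable_on_subset_banach by (metis has_sum_imp_summable subset_UNIV)
  have bij_nonneg: "bij_betw int UNIV {0..}" by (rule bij_betwI[where g = nat]) auto
  have bij_neg: "bij_betw (\<lambda>k. - 1 - int k) UNIV {..<0}" by (rule bij_betwI[where g = "\<lambda>n. nat (- 1 - n)"]) auto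
  have "((\<lambda>k. f (int k)) has_sum infsum f {0..}) UNIV"
    unfolding has_sum_reindex_bij_betw[OF bij_nonneg] by (rule has_sum_infsum[OF sm])
  moreover have "((\<lambda>k. f (- 1 - int k)) has_sum infsum f {..<0}) UNIV"
    unfolding has_sum_reindex_bij_betw[OF bij_neg] by (rule has_sum_infsum[OF sm])
  moreover have "infsum f ({0..} \<union> {..<0}) = infsum f {0..} + infsum f {..<0}"
    by (intro infsum_Un_disjoint sm) auto
  moreover have "{0..} \<union> {..<0} = (UNIV :: int set)" by auto
  ultimately show ?thesis
    using neg infsumI[OF assms(1)] by (auto dest!: has_sum_imp_sums dest: sums_unique2)
qed

theorem proposition7:
  fixes pp pm :: nat and \<epsilon> \<tau> :: complex and b c :: int
  assumes "pp \<ge> 1" and "pm \<ge> 1" and "coprime pp pm" and "pp \<noteq> pm"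
    and "Im \<tau> > 0"
    and "Re \<epsilon> \<noteq> 0"
    and "c \<noteq> 0"
  shows "integrable lborel
           (\<lambda>x :: real. S_kernel pp pm \<epsilon> b c x * fock_char pp pm \<epsilon> (x + alpha_zero pp pm / 2) \<tau>) \<and>
         false_theta pp pm \<epsilon> b c (- 1 / \<tau>) =
           - (LINT x|lborel. S_kernel pp pm \<epsilon> b c x * fock_char pp pm \<epsilon> (x + alpha_zero pp pm / 2) \<tau>)
           + 2 * (of_real ((1 - sgn (Re \<epsilon>)) / 2) * correction_term pp pm \<epsilon> b c \<tau>)"
proof -
  define s where "s = sqrt (2 * real pp * real pm)"
  define N where "N = pp * pm"
  define h where "h = csqrt (- \<i> * \<tau>)"
  define \<eta> where "\<eta> = dedekind_eta \<tau>"
  define J where "J d = (LINT x|lborel. wave s \<epsilon> \<tau> d x / (1 - ratio s \<epsilon> x))" for d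
  define D where "D = (J (b - c) - J (b + c)) / \<eta>"
  define PT where "PT d = (\<Sum>k. theta_term s \<epsilon> \<tau> d (int k))" for d
  note \<tau> = assms(5)
  have s: "s > 0" using assms(1,2) by (simp add: s_def)
  have s2: "s\<^sup>2 = 2 * real N" by (simp add: s_def N_def)
  have h0: "h \<noteq> 0" using \<tau> by (auto simp: h_def)
  have int: "integrable lborel (\<lambda>x. wave s \<epsilon> \<tau> d x / (1 - ratio s \<epsilon> x))" for d
    using theta_half_sum_pos(1)[OF \<tau> s] theta_half_sum_neg(1)[OF \<tau> s] assms(6) by (meson linorder_neqE)
  note kernel = S_kernel_fock_char[of pp pm, folded s_def, OF s assms(6)]
  have I1: "integrable lborel (\<lambda>x. S_kernel pp pm \<epsilon> b c x * fock_char pp pm \<epsilon> (x + alpha_zero pp pm / 2) \<tau>)"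
    unfolding kernel using int[of "b - c"] int[of "b + c"] by simp
  have I2: "(LINT x|lborel. S_kernel pp pm \<epsilon> b c x * fock_char pp pm \<epsilon> (x + alpha_zero pp pm / 2) \<tau>) = - D"
    unfolding kernel D_def J_def \<eta>_def minus_divide_left using int[of "b - c"] int[of "b + c"] by simp
  have ft: "false_theta pp pm \<epsilon> b c (- 1 / \<tau>) = (PT (b - c) - PT (b + c)) / (h * \<eta>)"
    unfolding false_theta_def s_def[symmetric] N_def[symmetric] partial_theta_eq[OF s2 s] dedekind_eta_inversion[OF \<tau>] PT_def h_def \<eta>_def
    by simp
  show ?thesis
  proof (intro conjI I1)
    consider "Re \<epsilon> > 0" | "Re \<epsilon> < 0" using assms(6) by linarith
    then show "false_theta pp pm \<epsilon> b c (- 1 / \<tau>) =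
           - (LINT x|lborel. S_kernel pp pm \<epsilon> b c x * fock_char pp pm \<epsilon> (x + alpha_zero pp pm / 2) \<tau>)
           + 2 * (of_real ((1 - sgn (Re \<epsilon>)) / 2) * correction_term pp pm \<epsilon> b c \<tau>)"
    proof cases
      case 1
      have PT: "PT d = h * J d" for d
        using theta_half_sum_pos(2)[OF \<tau> s 1, of d] unfolding PT_def h_def J_def by (rule sums_unique[symmetric])
      have "(PT (b - c) - PT (b + c)) / (h * \<eta>) = D"
        unfolding PT D_def right_diff_distrib[symmetric] using h0 by simp
      then show ?thesis unfolding I2 ft using 1 by simp
    next
      case 2
      define M where "M d = infsum (dual_theta_term s \<epsilon> \<tau> d) UNIV" for d
      have "PT d = h / of_real s * M d + h * J d" for d
        using has_sum_int_split[OF theta_full_sum[OF \<tau> s] theta_half_sum_neg(2)[OF \<tau> s 2], of d, THEN sums_unique]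
        unfolding PT_def M_def J_def h_def by simp
      then have "PT (b - c) - PT (b + c) = h * ((M (b - c) - M (b + c)) / of_real s + (J (b - c) - J (b + c)))"
        by (simp add: algebra_simps diff_divide_distrib)
      then have "false_theta pp pm \<epsilon> b c (- 1 / \<tau>) = (M (b - c) - M (b + c)) / (of_real s * \<eta>) + D"
        unfolding ft D_def using h0 by (simp add: add_divide_distrib)
      moreover have "2 * correction_term pp pm \<epsilon> b c \<tau> = (M (b - c) - M (b + c)) / (of_real s * \<eta>)"
        unfolding M_def \<eta>_def using correction_term_eq[of pp pm, folded s_def, OF s \<tau>] .
      ultimately show ?thesis using 2 unfolding I2 by simp
    qed
  qed
qed

end
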